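(* For each $n$, let $(\lambda_1,\dots,\lambda_n)$ be a random vector in $\mathbb{C}^n$ whose joint density with respect to Lebesgue measure is proportional to $$e^{-\sum_{k=1}^n|\lambda_k|^2}\prod_{j<k}|\lambda_j-\lambda_k|^2,$$ and let $X_j=\lambda_j/\sqrt n$. Let $p_n(z)=\prod_{k=1}^n(z-X_k)$ and $\Lambda_n=\{z\in\mathbb{C}:|p_n(z)|<1\}$. Given $r\in(0,1)$ and $s\in(1,\infty)$, for large $n$, $$\mathbb{D}_r\subseteq\Lambda_n\subseteq\mathbb{D}_s\quad\text{with overwhelming probability.}$$
   Context: $\mathbb{D}_r=\{z\in\mathbb{C}:|z|<r\}$. A sequence of events $E_n$ holds with overwhelming probability if there is a constant $c>0$ (independent of $n$) such that $\mathbb{P}(E_n)\ge 1-e^{-cn}$ for all sufficiently large $n$; here $c$ may depend on $r$ and $s$. *)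

theory Defs
  imports "HOL-Probability.Probability"
begin

definition overwhelming_probability :: "(nat \<Rightarrow> 'a measure) \<Rightarrow> (nat \<Rightarrow> 'a set) \<Rightarrow> bool" where
  "overwhelming_probability M E \<longleftrightarrow>
     (\<exists>c>0. \<forall>\<^sub>F n in sequentially.
        E n \<in> sets (M n) \<and> measure (M n) (E n) \<ge> 1 - exp (- c * real n))"

definition ginibre_weight :: "nat \<Rightarrow> (nat \<Rightarrow> complex) \<Rightarrow> real" where
  "ginibre_weight n x =
     exp (- (\<Sum>k=1..n. (cmod (x k))\<^sup>2)) * (\<Prod>k=1..n. \<Prod>j\<in>{1..<k}. (cmod (x j - x k))\<^sup>2)"

text \<open>Points of \<open>\<complex>\<^sup>n\<close> are represented as extensional functions on \<open>{1..n}\<close>, and Lebesgue measure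
  on \<open>\<complex>\<^sup>n\<close> as the \<open>n\<close>-fold product of planar Lebesgue measure.\<close>

definition ginibre_vector :: "'a measure \<Rightarrow> nat \<Rightarrow> (nat \<Rightarrow> 'a \<Rightarrow> complex) \<Rightarrow> bool" where
  "ginibre_vector M n lam \<longleftrightarrow>
     (\<exists>C>0. distributed M (\<Pi>\<^sub>M k\<in>{1..n}. lborel) (\<lambda>\<omega>. \<lambda>k\<in>{1..n}. lam k \<omega>)
        (\<lambda>x. ennreal (C * ginibre_weight n x)))"

definition root_poly :: "nat \<Rightarrow> (nat \<Rightarrow> complex) \<Rightarrow> complex \<Rightarrow> complex" where
  "root_poly n X z = (\<Prod>k=1..n. z - X k)"

definition lemniscate :: "nat \<Rightarrow> (nat \<Rightarrow> complex) \<Rightarrow> complex set" where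
  "lemniscate n X = {z. cmod (root_poly n X z) < 1}"

end

theory Submission
  imports Defs
begin

text \<open>
  Write \<open>Z(w)\<close> for the integral of the squared Vandermonde determinant against a product weight
  \<open>w\<close> on the plane, and \<open>m\<^sub>j(w)\<close> for the integral of \<open>|z|\<^sup>2\<^sup>j w(z)\<close>. Expanding one Vandermonde
  factor by Lagrange interpolation gives \<open>Z(w) \<le> n! m\<^sub>0(w) \<dots> m\<^sub>n\<^sub>-\<^sub>1(w)\<close>, with equality when \<open>w\<close>
  is radial. Hence expectations of \<open>\<Prod> g(\<lambda>\<^sub>k)\<close> under the Ginibre law are at most products of
  one-dimensional expectations.

  For the inner disc, the expectation of the Gaussian integral of \<open>|p\<^sub>n|\<^sup>2\<close> is a ratio of two
  consecutive normalising constants; the reproducing kernel of Fock space turns this into a bound for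
  the supremum of \<open>|p\<^sub>n|\<close> over \<open>|z| < r\<close> of order \<open>exp (- n (1 - r\<^sup>2) / 2)\<close>.

  For the outer region, truncating the weight shows that all \<open>|X\<^sub>k| \<le> \<rho>\<close> for some \<open>1 < \<rho> < s\<close>,
  and tilting it by \<open>exp (t Re (\<omega> X\<^sup>m))\<close> shows that each power sum \<open>\<Sum> X\<^sub>k\<^sup>m\<close> is at most
  \<open>\<delta> n\<close>, both up to exponentially small probability. The logarithmic series
  \<open>ln |p\<^sub>n(z)| = n ln |z| - Re (\<Sum> z\<^sup>-\<^sup>m (\<Sum> X\<^sub>k\<^sup>m) / m)\<close> then needs only finitely many
  of these sums to stay positive on \<open>|z| \<ge> s\<close>.
\<close>

section \<open>Rotation invariance and radial moments of planar Lebesgue measure\<close>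

text \<open>Convergence of the empirical measure would not suffice: the logarithm is singular at the
  roots, and both bounds must be uniform in \<open>z\<close> with exponentially small error.
  Outside, the roots are already separated from \<open>z\<close>, so the singularity is out of
  reach. A tilt that is a product over the points keeps Laplace transforms of power sums within the
  class of Vandermonde integrals, but tilted weights are not radial and the exact moment formula is
  lost. Chernoff's method asks only for an upper bound, which is why the inequality is developed for
  general weights. The tilt costs order t^2 per moment while the gain t \<delta> is linear, so a
  small t leaves a positive rate. Truncation has to come first: exp (t Re X^m) is not Gaussian
  integrable for t > 0 and m > 2.\<close>

lemma borel_measurable_Complex [measurable (raw)]:
  assumes "f \<in> borel_measurable M" "g \<in> borel_measurable M"
  shows "(\<lambda>x. Complex (f x) (g x)) \<in> borel_measurable M"
  using assms unfolding Complex_eq by measurable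

lemma lborel_complex_eq_distr:
  "lborel = distr (lborel \<Otimes>\<^sub>M lborel) borel (\<lambda>(x, y). Complex x y)"
proof (rule lborel_eqI)
  have [measurable]: "(\<lambda>(x, y). Complex x y) \<in> borel_measurable (lborel \<Otimes>\<^sub>M lborel)"
    unfolding split_beta' by measurable
  fix l u :: complex
  assume lu: "\<And>b. b \<in> Basis \<Longrightarrow> l \<bullet> b \<le> u \<bullet> b"
  have le: "Re l \<le> Re u" "Im l \<le> Im u"
    using lu[of 1] lu[of \<i>] by (auto simp: Basis_complex_def)
  have "(\<lambda>(x, y). Complex x y) -` box l u = {Re l<..<Re u} \<times> {Im l<..<Im u}"
    by (auto simp: box_def Basis_complex_def)
  then have "emeasure (distr (lborel \<Otimes>\<^sub>M lborel) borel (\<lambda>(x, y). Complex x y)) (box l u)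
     = emeasure (lborel \<Otimes>\<^sub>M lborel) ({Re l<..<Re u} \<times> {Im l<..<Im u})"
    by (subst emeasure_distr) (auto simp: space_pair_measure)
  also have "\<dots> = ennreal ((Re u - Re l) * (Im u - Im l))"
    using le by (subst lborel.emeasure_pair_measure_Times) (auto simp: ennreal_mult)
  finally show "emeasure (distr (lborel \<Otimes>\<^sub>M lborel) borel (\<lambda>(x, y). Complex x y)) (box l u)
     = ennreal (\<Prod>b\<in>Basis. (u - l) \<bullet> b)"
    by (simp add: Basis_complex_def complex_i_not_one)
qed simp

lemma nn_integral_lborel_complex:
  assumes [measurable]: "f \<in> borel_measurable borel"
  shows "(\<integral>\<^sup>+z. f z \<partial>lborel) = (\<integral>\<^sup>+y. \<integral>\<^sup>+x. f (Complex x y) \<partial>lborel \<partial>lborel)"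
    and "(\<integral>\<^sup>+z. f z \<partial>lborel) = (\<integral>\<^sup>+x. \<integral>\<^sup>+y. f (Complex x y) \<partial>lborel \<partial>lborel)"
proof -
  have [measurable]: "(\<lambda>(x, y). Complex x y) \<in> borel_measurable (lborel \<Otimes>\<^sub>M lborel)"
    unfolding split_beta' by measurable
  have eq: "(\<integral>\<^sup>+z. f z \<partial>lborel) = (\<integral>\<^sup>+p. f (Complex (fst p) (snd p)) \<partial>(lborel \<Otimes>\<^sub>M lborel))"
    by (subst lborel_complex_eq_distr, subst nn_integral_distr) (auto simp: split_beta')
  have [measurable]: "(\<lambda>p. f (Complex (fst p) (snd p))) \<in> borel_measurable (lborel \<Otimes>\<^sub>M lborel)"
    by measurable
  show "(\<integral>\<^sup>+z. f z \<partial>lborel) = (\<integral>\<^sup>+x. \<integral>\<^sup>+y. f (Complex x y) \<partial>lborel \<partial>lborel)"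
    unfolding eq by (subst lborel.nn_integral_fst[symmetric]) auto
  show "(\<integral>\<^sup>+z. f z \<partial>lborel) = (\<integral>\<^sup>+y. \<integral>\<^sup>+x. f (Complex x y) \<partial>lborel \<partial>lborel)"
    unfolding eq by (subst lborel_pair.nn_integral_snd[symmetric]) (auto simp: split_beta')
qed

lemma nn_integral_lborel_shift:
  assumes [measurable]: "f \<in> borel_measurable borel"
  shows "(\<integral>\<^sup>+x. f (x + t) \<partial>lborel) = (\<integral>\<^sup>+x. f (x::real) \<partial>lborel)"
  using nn_integral_real_affine[of f 1 t] by (simp add: add.commute)

text \<open>On each horizontal line the shear is a translation by \<open>a * Im z\<close>, so Fubini
  reduces the claim to translation invariance on the real line.\<close>

lemma nn_integral_shear_Re:
  assumes [measurable]: "f \<in> borel_measurable borel"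
  shows "(\<integral>\<^sup>+z. f (Complex (Re z + a * Im z) (Im z)) \<partial>lborel) = (\<integral>\<^sup>+z. f z \<partial>lborel)"
proof -
  have [measurable]: "(\<lambda>z. f (Complex (Re z + a * Im z) (Im z))) \<in> borel_measurable borel"
    "(\<lambda>x. f (Complex x y)) \<in> borel_measurable borel" for y
    by measurable
  show ?thesis
    by (simp add: nn_integral_lborel_complex(1) nn_integral_lborel_shift[of "\<lambda>x. f (Complex x _)"])
qed

lemma nn_integral_shear_Im:
  assumes [measurable]: "f \<in> borel_measurable borel"
  shows "(\<integral>\<^sup>+z. f (Complex (Re z) (Im z + a * Re z)) \<partial>lborel) = (\<integral>\<^sup>+z. f z \<partial>lborel)"
proof -
  have [measurable]: "(\<lambda>z. f (Complex (Re z) (Im z + a * Re z))) \<in> borel_measurable borel"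
    "(\<lambda>y. f (Complex x y)) \<in> borel_measurable borel" for x
    by measurable
  show ?thesis
    by (simp add: nn_integral_lborel_complex(2) nn_integral_lborel_shift[of "\<lambda>y. f (Complex _ y)"])
qed

text \<open>A rotation by an angle that is not a multiple of \<open>\<pi>\<close> is a product of three shears.\<close>

lemma nn_integral_rotate:
  assumes [measurable]: "f \<in> borel_measurable borel"
    and u: "cmod u = 1" "Im u \<noteq> 0"
  shows "(\<integral>\<^sup>+z. f (u * z) \<partial>lborel) = (\<integral>\<^sup>+z. f z \<partial>lborel)"
proof -
  \<comment> \<open>For \<open>u = cis \<theta>\<close> this is - tan (\<theta> / 2), the slope of
    the two outer horizontal shears; the vertical one between them has slope sin \<theta>.\<close>
  define a where "a = (Re u - 1) / Im u"
  have uu: "(Re u)\<^sup>2 + (Im u)\<^sup>2 = 1"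
    using u(1) by (metis cmod_power2 one_power2)
  define F where "F z = f (Complex (Re z + a * Im z) (Im z))" for z
  define G where "G z = F (Complex (Re z) (Im z + Im u * Re z))" for z
  have [measurable]: "F \<in> borel_measurable borel"
    unfolding F_def by measurable
  have [measurable]: "G \<in> borel_measurable borel"
    unfolding G_def by measurable
  have ai: "a * Im u = Re u - 1" using u(2) by (simp add: a_def)
  have a2: "a * (1 + Re u) = - Im u"
    using uu u(2) by (simp add: a_def field_simps power2_eq_square)
  have "f (u * z) = G (Complex (Re z + a * Im z) (Im z))" for z
  proof -
    have "Im z + Im u * (Re z + a * Im z) = Im z * (1 + a * Im u) + Im u * Re z"
      by (simp add: algebra_simps)
    then have 1: "Im z + Im u * (Re z + a * Im z) = Im (u * z)"
      unfolding ai by (simp add: algebra_simps)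
    have "Re z + a * Im z + a * Im (u * z) = Re z * (1 + a * Im u) + a * (1 + Re u) * Im z"
      by (simp add: algebra_simps)
    also have "\<dots> = Re (u * z)"
      unfolding ai a2 by (simp add: algebra_simps)
    finally show ?thesis
      using 1 by (simp add: G_def F_def complex_eq_iff) (metis complex_surj times_complex.simps)
  qed
  then have "(\<integral>\<^sup>+z. f (u * z) \<partial>lborel) = (\<integral>\<^sup>+z. G z \<partial>lborel)"
    using nn_integral_shear_Re[of G a] by simp
  also have "\<dots> = (\<integral>\<^sup>+z. F z \<partial>lborel)"
    unfolding G_def by (rule nn_integral_shear_Im) simp
  also have "\<dots> = (\<integral>\<^sup>+z. f z \<partial>lborel)"
    unfolding F_def by (rule nn_integral_shear_Re) simp
  finally show ?thesis .
qed

lemma lborel_distr_rotate: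
  assumes u: "cmod u = 1" "Im u \<noteq> 0"
  shows "distr lborel borel ((*) u) = lborel"
proof (rule measure_eqI)
  fix A assume "A \<in> sets (distr lborel borel ((*) u))"
  then have A[measurable]: "A \<in> sets borel" by simp
  have "emeasure (distr lborel borel ((*) u)) A = (\<integral>\<^sup>+z. indicator A z \<partial>distr lborel borel ((*) u))"
    by simp
  also have "\<dots> = (\<integral>\<^sup>+z. indicator A (u * z) \<partial>lborel)"
    by (rule nn_integral_distr) auto
  also have "\<dots> = emeasure lborel A"
    using nn_integral_rotate[of "indicator A" u] u by simp
  finally show "emeasure (distr lborel borel ((*) u)) A = emeasure lborel A" .
qed simp

text \<open>Rotating by \<open>u\<close> multiplies the integral by
  \<open>u ^ a * cnj (u ^ b)\<close>; as soon as this factor differs from 1, the integral must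
  vanish.\<close>

lemma integral_power_cnj_power_radial_eq_0:
  fixes w :: "complex \<Rightarrow> real"
  assumes [measurable]: "w \<in> borel_measurable borel"
    and rad: "\<And>u z. cmod u = 1 \<Longrightarrow> w (u * z) = w z"
    and ab: "a \<noteq> b"
  shows "(\<integral>z. z ^ a * cnj (z ^ b) * of_real (w z) \<partial>lborel) = 0"
proof -
  define d where "d = real_of_int (int a - int b)"
  have d: "\<bar>d\<bar> \<ge> 1" using ab unfolding d_def by linarith
  \<comment> \<open>This angle makes the factor exactly \<open>cis 1\<close>; since 0 < |t| \<le> 1
    < pi, it is not a multiple of pi and the shear decomposition applies.\<close>
  define t where "t = 1 / d"
  define u where "u = cis t"
  have t: "t \<noteq> 0" "\<bar>t\<bar> \<le> 1" using d by (auto simp: t_def divide_simps)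
  have pi: "pi > 2" using pi_gt3 by simp
  have "sin t \<noteq> 0"
  proof (cases "t > 0")
    case True then show ?thesis using sin_gt_zero[of t] t pi by auto
  next
    case False then show ?thesis using sin_gt_zero[of "-t"] t pi by auto
  qed
  then have u: "cmod u = 1" "Im u \<noteq> 0" by (auto simp: u_def)
  let ?f = "\<lambda>z. z ^ a * cnj (z ^ b) * of_real (w z)"
  have [measurable]: "cnj \<in> borel_measurable borel"
    by (intro borel_measurable_continuous_onI continuous_intros)
  have "integral\<^sup>L lborel ?f = integral\<^sup>L (distr lborel borel ((*) u)) ?f"
    by (simp only: lborel_distr_rotate[OF u])
  also have "\<dots> = (\<integral>z. ?f (u * z) \<partial>lborel)"
    by (rule integral_distr) auto
  also have "\<dots> = (\<integral>z. (u ^ a * cnj (u ^ b)) * ?f z \<partial>lborel)"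
    using rad[OF u(1)] by (simp add: power_mult_distrib mult_ac)
  also have "\<dots> = (u ^ a * cnj (u ^ b)) * integral\<^sup>L lborel ?f"
    by simp
  finally have eq: "integral\<^sup>L lborel ?f = (u ^ a * cnj (u ^ b)) * integral\<^sup>L lborel ?f" .
  have "u ^ a * cnj (u ^ b) = cis (d * t)"
    by (simp add: u_def d_def cis_cnj cis_mult algebra_simps Complex.DeMoivre)
  also have "d * t = 1" using d by (auto simp: t_def)
  finally have "u ^ a * cnj (u ^ b) = cis 1" .
  moreover have "cis 1 \<noteq> (1::complex)"
    using sin_gt_zero[of 1] pi by (auto simp: complex_eq_iff)
  ultimately show ?thesis using eq by auto
qed

text \<open>The annulus a < |z|^2 \<le> b has area pi (b - a). For radial integrands this does the
  work of polar coordinates.\<close>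

lemma lborel_distr_cmod_power2:
  "distr lborel borel (\<lambda>z::complex. (cmod z)\<^sup>2) = density lborel (\<lambda>u. ennreal pi * indicator {0..} u)"
proof (rule measure_eqI_generator_eq[where E="range (\<lambda>(a,b). {a<..b::real})" and \<Omega>=UNIV
      and A="\<lambda>n. {- real n<..real n}"])
  show "Int_stable (range (\<lambda>(a,b). {a<..b::real}))"
    by (auto simp: Int_stable_def)
  show "range (\<lambda>(a,b). {a<..b::real}) \<subseteq> Pow UNIV" by auto
  have sb: "sets borel = sigma_sets UNIV (range (\<lambda>(a,b). {a<..b::real}))"
    by (subst borel_sigma_sets_Ioc) simp
  show "sets (distr lborel borel (\<lambda>z::complex. (cmod z)\<^sup>2)) = sigma_sets UNIV (range (\<lambda>(a,b). {a<..b::real}))"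
    "sets (density lborel (\<lambda>u. ennreal pi * indicator {0..} u)) = sigma_sets UNIV (range (\<lambda>(a,b). {a<..b::real}))"
    by (simp_all add: sb)
  show "range (\<lambda>n. {- real n<..real n}) \<subseteq> range (\<lambda>(a,b). {a<..b::real})" by auto
  show "(\<Union>n. {- real n<..real n}) = UNIV"
  proof safe
    fix x :: real
    obtain n :: nat where "real n > \<bar>x\<bar>" using reals_Archimedean2 by blast
    then show "x \<in> (\<Union>n. {- real n<..real n})" by (intro UN_I[of n]) auto
  qed auto
  have cb: "(\<lambda>z. (cmod z)\<^sup>2) -` {a<..b} = cball 0 (sqrt b) - (if a < 0 then {} else cball 0 (sqrt a))"
    if "b \<ge> 0" for a b :: real
  proof -
    have 1: "(cmod z)\<^sup>2 \<le> c \<longleftrightarrow> cmod z \<le> sqrt c" if "c \<ge> 0" for z c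
      using that by (metis norm_ge_zero real_le_rsqrt real_sqrt_le_iff real_sqrt_abs abs_of_nonneg)
    show ?thesis using that 1[of b] 1[of a] by (auto simp: not_le[symmetric] not_less dual_order.strict_trans1) 
       (smt (verit) zero_le_power2)+
  qed
  show eq: "emeasure (distr lborel borel (\<lambda>z::complex. (cmod z)\<^sup>2)) X
       = emeasure (density lborel (\<lambda>u. ennreal pi * indicator {0..} u)) X"
    if XE: "X \<in> range (\<lambda>(a,b). {a<..b::real})" for X
  proof -
    obtain a b where X: "X = {a<..b}" using XE by auto
    have "emeasure (density lborel (\<lambda>u. ennreal pi * indicator {0..} u)) X
      = (\<integral>\<^sup>+u. ennreal pi * indicator ({0..} \<inter> {a<..b}) u \<partial>lborel)"
      by (simp add: X emeasure_density indicator_inter_arith mult_ac)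
    also have "\<dots> = ennreal pi * emeasure lborel ({0..} \<inter> {a<..b})"
      by (simp add: nn_integral_cmult)
    finally have R: "emeasure (density lborel (\<lambda>u. ennreal pi * indicator {0..} u)) X
      = ennreal pi * emeasure lborel ({0..} \<inter> {a<..b})" .
    have L: "emeasure (distr lborel borel (\<lambda>z::complex. (cmod z)\<^sup>2)) X
       = emeasure lborel ((\<lambda>z::complex. (cmod z)\<^sup>2) -` {a<..b})"
      by (simp add: X emeasure_distr)
    have e: "emeasure lborel (cball (0::complex) (sqrt c)) = ennreal (pi * c)" if "c \<ge> 0" for c
      using that emeasure_cball[of "sqrt c" "0::complex"] by (simp add: unit_ball_vol_2)
    consider "b < 0 \<or> b \<le> a" | "b \<ge> 0" "a < 0" | "0 \<le> a" "a < b" by linarith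
    then show ?thesis
    proof cases
      case 1
      then have "(\<lambda>z::complex. (cmod z)\<^sup>2) -` {a<..b} = {}" "{0..} \<inter> {a<..b} = {}"
        by (auto simp: not_le) (meson not_le order.trans zero_le_power2)
      then show ?thesis unfolding L R by simp
    next
      case 2
      then have "{0..} \<inter> {a<..b} = {0..b}" by auto
      then show ?thesis unfolding L R using 2 e by (simp add: cb ennreal_mult)
    next
      case 3
      then have "{0..} \<inter> {a<..b} = {a<..b}" by auto
      moreover have "emeasure lborel (cball (0::complex) (sqrt b) - cball 0 (sqrt a))
         = emeasure lborel (cball (0::complex) (sqrt b)) - emeasure lborel (cball (0::complex) (sqrt a))"
        using 3 e by (intro emeasure_Diff) (auto simp: real_sqrt_le_mono order.trans[OF _ real_sqrt_le_mono])
      moreover have "ennreal (pi * b) - ennreal (pi * a) = ennreal pi * ennreal (b - a)"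
        using 3 by (simp add: ennreal_mult[symmetric] ennreal_minus right_diff_distrib)
      ultimately show ?thesis unfolding L R using 3 e by (simp add: cb)
    qed
  qed
  have "emeasure (density lborel (\<lambda>u. ennreal pi * indicator {0..} u)) {- real n<..real n} \<noteq> \<infinity>" for n
  proof -
    have "emeasure (density lborel (\<lambda>u. ennreal pi * indicator {0..} u)) {- real n<..real n}
      \<le> (\<integral>\<^sup>+u. ennreal pi * indicator {- real n<..real n} u \<partial>lborel)"
      by (subst emeasure_density) (auto intro!: nn_integral_mono simp: indicator_def)
    also have "\<dots> < \<infinity>" by (simp add: nn_integral_cmult ennreal_mult_less_top)
    finally show ?thesis by simp
  qed
  then show "emeasure (distr lborel borel (\<lambda>z::complex. (cmod z)\<^sup>2)) {- real n<..real n} \<noteq> \<infinity>" for n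
    using eq[OF range_eqI[of _ _ "(- real n, real n)"]] by simp
qed

text \<open>The substitution u = |z|^2 gives a Gamma integral, read off from the total mass of an
  Erlang density. Rates \<open>l\<close> other than 1 serve the Chernoff bound for truncated
  moments.\<close>

lemma nn_integral_gaussian_moment:
  assumes l: "l > 0"
  shows "(\<integral>\<^sup>+z. ennreal (cmod z ^ (2 * k) * exp (- l * (cmod z)\<^sup>2)) \<partial>lborel)
    = ennreal (pi * fact k / l ^ Suc k)"
proof -
  have "(\<integral>\<^sup>+z. ennreal (cmod z ^ (2 * k) * exp (- l * (cmod z)\<^sup>2)) \<partial>lborel)
     = (\<integral>\<^sup>+u. ennreal (u ^ k * exp (- l * u)) \<partial>distr lborel borel (\<lambda>z::complex. (cmod z)\<^sup>2))"
    by (subst nn_integral_distr) (auto simp: power_mult)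
  also have "\<dots> = (\<integral>\<^sup>+u. ennreal pi * indicator {0..} u * ennreal (u ^ k * exp (- l * u)) \<partial>lborel)"
    unfolding lborel_distr_cmod_power2 by (subst nn_integral_density) auto
  also have "\<dots> = (\<integral>\<^sup>+u. ennreal (pi * fact k / l ^ Suc k) * ennreal (erlang_density k l u) \<partial>lborel)"
  proof (rule nn_integral_cong)
    fix u :: real
    show "ennreal pi * indicator {0..} u * ennreal (u ^ k * exp (- l * u))
      = ennreal (pi * fact k / l ^ Suc k) * ennreal (erlang_density k l u)"
      using l by (auto simp: erlang_density_def ennreal_mult[symmetric] indicator_def)
  qed
  also have "\<dots> = ennreal (pi * fact k / l ^ Suc k) * (\<integral>\<^sup>+u. ennreal (erlang_density k l u) \<partial>lborel)"
    by (rule nn_integral_cmult) simp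
  also have "(\<integral>\<^sup>+u. ennreal (erlang_density k l u) \<partial>lborel) = 1"
    using nn_integral_erlang_ith_moment[OF l, of k 0] by simp
  finally show ?thesis by simp
qed

section \<open>The squared Vandermonde determinant and Lagrange interpolation\<close>

definition node_poly :: "nat set \<Rightarrow> (nat \<Rightarrow> complex) \<Rightarrow> complex \<Rightarrow> complex" where
  "node_poly J x z = (\<Prod>j\<in>J. z - x j)"

text \<open>Every unordered pair is counted twice, so this is the square of the modulus of the
  Vandermonde determinant, written without an ordering of the index set.\<close>

definition vdm :: "nat set \<Rightarrow> (nat \<Rightarrow> complex) \<Rightarrow> real" where
  "vdm I x = (\<Prod>i\<in>I. \<Prod>j\<in>I - {i}. cmod (x i - x j))"

lemma node_poly_cong: "(\<And>j. j \<in> J \<Longrightarrow> x j = y j) \<Longrightarrow> node_poly J x z = node_poly J y z"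
  unfolding node_poly_def by (intro prod.cong) auto

lemma vdm_cong: "(\<And>j. j \<in> I \<Longrightarrow> x j = y j) \<Longrightarrow> vdm I x = vdm I y"
  unfolding vdm_def by (intro prod.cong) auto

lemma vdm_nonneg: "0 \<le> vdm I x"
  unfolding vdm_def by (intro prod_nonneg) auto

lemma vdm_insert:
  assumes "finite J" "k \<notin> J"
  shows "vdm (insert k J) x = vdm J x * (cmod (node_poly J x (x k)))\<^sup>2"
proof -
  have *: "insert k J - {i} = insert k (J - {i})" if "i \<in> J" for i
    using that assms by auto
  have "(\<Prod>i\<in>J. \<Prod>j\<in>insert k J - {i}. cmod (x i - x j))
      = (\<Prod>i\<in>J. cmod (x i - x k) * (\<Prod>j\<in>J - {i}. cmod (x i - x j)))"
    using assms by (intro prod.cong) (auto simp: *)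
  also have "\<dots> = cmod (node_poly J x (x k)) * vdm J x"
    by (simp add: prod.distrib vdm_def node_poly_def prod_norm[symmetric] norm_minus_commute)
  finally show ?thesis
    using assms by (simp add: vdm_def node_poly_def prod_norm[symmetric] power2_eq_square insert_Diff_if)
qed

lemma vdm_remove:
  assumes "finite I" "k \<in> I"
  shows "vdm I x = vdm (I - {k}) x * (cmod (node_poly (I - {k}) x (x k)))\<^sup>2"
  using vdm_insert[of "I - {k}" k x] assms by (simp add: insert_absorb)

lemma vdm_eq_0:
  assumes "finite I" "\<not> inj_on x I"
  shows "vdm I x = 0"
proof -
  obtain i j where "i \<in> I" "j \<in> I" "i \<noteq> j" "x i = x j"
    using assms(2) by (auto simp: inj_on_def)
  then show ?thesis
    using assms(1) unfolding vdm_def by (subst prod_zero_iff; force)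
qed

lemma ginibre_weight_eq_vdm:
  "ginibre_weight n x = vdm {1..n} x * (\<Prod>k\<in>{1..n}. exp (- (cmod (x k))\<^sup>2))"
proof -
  have "(\<Prod>k=1..n. \<Prod>j\<in>{1..<k}. (cmod (x j - x k))\<^sup>2) = vdm {1..n} x"
  proof (induction n)
    case (Suc n)
    have "{1..Suc n} = insert (Suc n) {1..n}" by auto
    then show ?case using Suc vdm_insert[of "{1..n}" "Suc n" x]
      by (simp add: node_poly_def prod_norm[symmetric] prod_power_distrib
          norm_minus_commute atLeastLessThanSuc_atLeastAtMost mult_ac)
  qed (simp add: vdm_def)
  then show ?thesis
    by (simp add: ginibre_weight_def exp_sum sum_negf[symmetric] mult_ac)
qed

lemma coeff_prod_linear_card:
  fixes x :: "nat \<Rightarrow> complex"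
  assumes "finite J"
  shows "degree (\<Prod>j\<in>J. [:- x j, 1:]) = card J" "coeff (\<Prod>j\<in>J. [:- x j, 1:]) (card J) = 1"
proof -
  show 1: "degree (\<Prod>j\<in>J. [:- x j, 1:]) = card J"
    by (subst degree_prod_eq_sum_degree) auto
  show "coeff (\<Prod>j\<in>J. [:- x j, 1:]) (card J) = 1"
    using lead_coeff_prod[of "\<lambda>j. [:- x j, 1:]" J] by (simp add: 1)
qed

lemma node_poly_eq_poly: "node_poly J x z = poly (\<Prod>j\<in>J. [:- x j, 1:]) z"
  by (simp add: node_poly_def poly_prod)

text \<open>The difference of \<open>z ^ card J\<close> and its Lagrange interpolant at the nodes is
  monic of degree \<open>card J\<close> and vanishes at every node, which determines it.\<close>

lemma node_poly_interpolation:
  assumes J: "finite J" and inj: "inj_on x J"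
  shows "node_poly J x z
    = z ^ card J - (\<Sum>k\<in>J. x k ^ card J * node_poly (J - {k}) x z / node_poly (J - {k}) x (x k))"
proof -
  define P where "P K = (\<Prod>j\<in>K. [:- x j, 1:])" for K
  define R where "R = (\<Sum>k\<in>J. smult (x k ^ card J / node_poly (J - {k}) x (x k)) (P (J - {k})))"
  have degP: "degree (P (J - {k})) < card J" if "k \<in> J" for k
  proof -
    have "card J > 0" using that J by (auto simp: card_gt_0_iff)
    then show ?thesis
      using coeff_prod_linear_card(1)[of "J - {k}" x] that J by (simp add: P_def)
  qed
  have cR: "coeff R (card J) = 0"
    unfolding R_def coeff_sum using degP by (intro sum.neutral) (auto simp: coeff_eq_0)
  have dR: "degree R \<le> card J"
    unfolding R_def using degP J by (intro degree_sum_le) (auto intro: order.trans[OF degree_smult_le] less_imp_le)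
  have zero: "node_poly (J - {l}) x (x k) = 0" if "k \<in> J" "l \<noteq> k" for k l
    using that J by (auto simp: node_poly_def)
  have nz: "node_poly (J - {k}) x (x k) \<noteq> 0" if "k \<in> J" for k
    using that J inj by (auto simp: node_poly_def inj_on_def)
  have "P J = monom 1 (card J) - R"
  proof (rule poly_eqI_degree_lead_coeff[where n = "card J" and A = "x ` J"])
    show "degree (P J) \<le> card J" "coeff (P J) (card J) = coeff (monom 1 (card J) - R) (card J)"
      using coeff_prod_linear_card[OF J] cR by (simp_all add: P_def)
    show "degree (monom 1 (card J) - R) \<le> card J"
      using dR by (intro degree_diff_le) (auto simp: degree_monom_le)
    show "card (x ` J) \<ge> card J"
      using inj by (simp add: card_image)
    fix y assume "y \<in> x ` J"
    then obtain k where k: "k \<in> J" "y = x k" by auto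
    have "poly R y = (\<Sum>l\<in>J. x l ^ card J / node_poly (J - {l}) x (x l) * node_poly (J - {l}) x (x k))"
      by (simp add: R_def poly_sum P_def k node_poly_eq_poly)
    also have "\<dots> = (\<Sum>l\<in>J. if l = k then x k ^ card J else 0)"
      using nz zero k by (intro sum.cong) auto
    also have "\<dots> = x k ^ card J" using k J by simp
    finally show "poly (P J) y = poly (monom 1 (card J) - R) y"
      using k J by (auto simp: P_def poly_prod poly_monom)
  qed
  from arg_cong[OF this, of "\<lambda>p. poly p z"] show ?thesis
    by (simp add: P_def node_poly_eq_poly R_def poly_sum poly_monom)
qed

text \<open>As division by zero gives zero, this includes \<open>c = 0\<close>; cancelling a node
  polynomial then needs no proof that it is nonzero.\<close>

lemma complex_norm_square_div:
  "of_real ((cmod c)\<^sup>2) / cnj c = c" "of_real ((cmod c)\<^sup>2) / c = cnj c"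
  by (cases "c = 0"; simp add: complex_norm_square del: of_real_power)+

text \<open>Multiplying the interpolation formula by the Vandermonde factor clears its denominators.
  The result survives colliding nodes, where \<open>vdm J x\<close> and each
  \<open>vdm (J - {k}) x * node_poly (J - {k}) x (x k)\<close> vanish.\<close>

lemma vdm_mult_cnj_node_poly:
  assumes J: "finite J"
  shows "of_real (vdm J x) * cnj (node_poly J x z)
    = of_real (vdm J x) * cnj z ^ card J
      - (\<Sum>k\<in>J. of_real (vdm (J - {k}) x) * cnj (x k ^ card J)
          * node_poly (J - {k}) x (x k) * cnj (node_poly (J - {k}) x z))"
proof (cases "inj_on x J")
  case True
  have "of_real (vdm J x) * cnj (x k ^ card J * node_poly (J - {k}) x z / node_poly (J - {k}) x (x k))
      = of_real (vdm (J - {k}) x) * cnj (x k ^ card J)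
          * node_poly (J - {k}) x (x k) * cnj (node_poly (J - {k}) x z)" if "k \<in> J" for k
  proof -
    let ?c = "node_poly (J - {k}) x (x k)"
    have "of_real (vdm J x) * cnj (x k ^ card J * node_poly (J - {k}) x z / ?c)
      = of_real (vdm (J - {k}) x) * cnj (x k ^ card J) * cnj (node_poly (J - {k}) x z)
         * (of_real ((cmod ?c)\<^sup>2) / cnj ?c)"
      unfolding vdm_remove[OF J that, of x] by simp
    then show ?thesis unfolding complex_norm_square_div by (simp add: mult_ac)
  qed
  then show ?thesis
    by (subst node_poly_interpolation[OF J True])
      (simp add: right_diff_distrib sum_distrib_left cong: sum.cong)
next
  case False
  have "of_real (vdm (J - {k}) x) * node_poly (J - {k}) x (x k) = 0" if k: "k \<in> J" for k
  proof (rule ccontr)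
    assume "\<not> ?thesis"
    then have "vdm J x \<noteq> 0" unfolding vdm_remove[OF J k, of x] by simp
    with vdm_eq_0[OF J False] show False by simp
  qed
  then have "(\<Sum>k\<in>J. of_real (vdm (J - {k}) x) * cnj (x k ^ card J)
          * node_poly (J - {k}) x (x k) * cnj (node_poly (J - {k}) x z)) = 0"
    by (intro sum.neutral) (auto simp: mult_ac)
  then show ?thesis using vdm_eq_0[OF J False] by simp
qed

text \<open>In determinant language, one Vandermonde factor is expanded along its row of n-th powers
  while the other is kept. Here it is the identity \<Sum> x_k^n / \<Prod> (x_k - x_j) = 1 for n + 1
  distinct nodes, cleared of denominators.\<close>

lemma vdm_expand:
  assumes I: "finite I" "card I = Suc n"
  shows "of_real (vdm I x)
    = (\<Sum>k\<in>I. of_real (vdm (I - {k}) x) * x k ^ n * cnj (node_poly (I - {k}) x (x k)))"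
proof (cases "inj_on x I")
  case True
  \<comment> \<open>One node is set aside and the interpolation formula for the others is evaluated
    there; dividing by its nonzero left-hand side gives \<open>one\<close>.\<close>
  obtain a where a: "a \<in> I" using I by fastforce
  define J where "J = I - {a}"
  have J: "finite J" "inj_on x J" "card J = n" "a \<notin> J" "I = insert a J"
    using I a True by (auto simp: J_def inj_on_diff)
  have nz: "node_poly (I - {k}) x (x k) \<noteq> 0" if "k \<in> I" for k
    using that I True by (auto simp: node_poly_def inj_on_def)
  let ?c = "node_poly J x (x a)"
  have c: "?c \<noteq> 0" using nz[OF a] by (simp add: J_def)
  have t: "x k ^ n * node_poly (J - {k}) x (x a) / node_poly (J - {k}) x (x k)
     = - (?c * (x k ^ n / node_poly (I - {k}) x (x k)))" if k: "k \<in> J" for k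
  proof -
    have ik: "I - {k} = insert a (J - {k})" "k \<noteq> a" using J k by auto
    have 1: "node_poly (I - {k}) x (x k) = (x k - x a) * node_poly (J - {k}) x (x k)"
      using J unfolding ik(1) node_poly_def by simp
    have 2: "?c = (x a - x k) * node_poly (J - {k}) x (x a)"
      using J k unfolding node_poly_def by (subst prod.remove[of J k]) auto
    have "x k \<noteq> x a" using True k a ik J by (auto simp: inj_on_def)
    then show ?thesis using nz[of k] J(5) k unfolding 1 2 by (simp add: field_simps)
  qed
  have "?c = x a ^ n - (\<Sum>k\<in>J. x k ^ n * node_poly (J - {k}) x (x a) / node_poly (J - {k}) x (x k))"
    using node_poly_interpolation[OF J(1,2), of "x a"] by (simp add: J(3))
  also have "\<dots> = x a ^ n + ?c * (\<Sum>k\<in>J. x k ^ n / node_poly (I - {k}) x (x k))"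
    using t by (simp add: sum_negf sum_distrib_left cong: sum.cong)
  also have "x a ^ n = ?c * (x a ^ n / node_poly (I - {a}) x (x a))"
    using c by (simp add: J_def)
  finally have "?c * 1 = ?c * (\<Sum>k\<in>I. x k ^ n / node_poly (I - {k}) x (x k))"
    using J by (simp add: distrib_left)
  with c have one: "(\<Sum>k\<in>I. x k ^ n / node_poly (I - {k}) x (x k)) = 1"
    by (metis mult_cancel_left)
  have "of_real (vdm I x) = (\<Sum>k\<in>I. of_real (vdm I x) * (x k ^ n / node_poly (I - {k}) x (x k)))"
    unfolding sum_distrib_left[symmetric] one by simp
  also have "\<dots> = (\<Sum>k\<in>I. of_real (vdm (I - {k}) x) * x k ^ n * cnj (node_poly (I - {k}) x (x k)))"
  proof (rule sum.cong)
    fix k assume k: "k \<in> I"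
    let ?d = "node_poly (I - {k}) x (x k)"
    have "of_real (vdm I x) * (x k ^ n / ?d)
       = of_real (vdm (I - {k}) x) * x k ^ n * (of_real ((cmod ?d)\<^sup>2) / ?d)"
      unfolding vdm_remove[OF I(1) k, of x] by simp
    then show "of_real (vdm I x) * (x k ^ n / ?d) = of_real (vdm (I - {k}) x) * x k ^ n * cnj ?d"
      unfolding complex_norm_square_div .
  qed simp
  finally show ?thesis .
next
  case False
  have "of_real (vdm (I - {k}) x) * cnj (node_poly (I - {k}) x (x k)) = 0" if k: "k \<in> I" for k
  proof (rule ccontr)
    assume "\<not> ?thesis"
    then have "vdm I x \<noteq> 0" unfolding vdm_remove[OF I(1) k, of x] by simp
    with vdm_eq_0[OF I(1) False] show False by simp
  qed
  then have "(\<Sum>k\<in>I. of_real (vdm (I - {k}) x) * x k ^ n * cnj (node_poly (I - {k}) x (x k))) = 0"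
    by (intro sum.neutral) (auto simp: mult_ac)
  then show ?thesis using vdm_eq_0[OF I(1) False] by simp
qed

section \<open>A Fischer-type inequality for Vandermonde integrals\<close>

interpretation lborel_product: product_sigma_finite "\<lambda>_::nat. lborel :: complex measure"
  by standard

abbreviation lborel_on :: "nat set \<Rightarrow> (nat \<Rightarrow> complex) measure" where
  "lborel_on I \<equiv> \<Pi>\<^sub>M i\<in>I. lborel"

text \<open>A class closed under the algebraic operations in play, so that integrability follows by
  introduction rules. The product form of the bound matches product weights: against
  \<open>wprod\<close> it factors into one-variable integrals.\<close>

definition poly_growth ::
    "nat set \<Rightarrow> ((nat \<Rightarrow> complex) \<Rightarrow> 'b::{real_normed_field, second_countable_topology}) \<Rightarrow> bool" where
  "poly_growth I F \<longleftrightarrow> F \<in> borel_measurable (lborel_on I) \<and>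
     (\<exists>C\<ge>0. \<exists>N. \<forall>x. norm (F x) \<le> C * (\<Prod>i\<in>I. 1 + cmod (x i)) ^ N)"

lemma prod_one_plus_ge_1: "1 \<le> (\<Prod>i\<in>I. 1 + cmod (x i))"
  by (intro prod_ge_1) auto

lemma poly_growthD: "poly_growth I F \<Longrightarrow> F \<in> borel_measurable (lborel_on I)"
  by (simp add: poly_growth_def)

lemma poly_growth_const: "poly_growth I (\<lambda>x. c)"
  unfolding poly_growth_def by (intro conjI exI[of _ "norm c"] exI[of _ 0]) auto

lemma poly_growth_component:
  assumes "finite I" "i \<in> I"
  shows "poly_growth I (\<lambda>x. x i)"
proof -
  have "cmod (x i) \<le> 1 * (\<Prod>i\<in>I. 1 + cmod (x i)) ^ 1" for x :: "nat \<Rightarrow> complex"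
  proof -
    have "cmod (x i) \<le> 1 + cmod (x i)" by simp
    also have "\<dots> * 1 \<le> (1 + cmod (x i)) * (\<Prod>i\<in>I - {i}. 1 + cmod (x i))"
      by (intro mult_left_mono prod_one_plus_ge_1) auto
    also have "\<dots> = (\<Prod>i\<in>I. 1 + cmod (x i))"
      using assms by (simp add: prod.remove[of I i])
    finally show ?thesis by simp
  qed
  moreover have "(\<lambda>x. x i) \<in> borel_measurable (lborel_on I)"
    using assms by measurable
  ultimately show ?thesis
    unfolding poly_growth_def by (intro conjI exI[of _ 1] exI[of _ 1]) auto
qed

lemma poly_growth_mult:
  assumes "poly_growth I F" "poly_growth I G"
  shows "poly_growth I (\<lambda>x. F x * G x)"
proof -
  obtain C1 N1 C2 N2 where *: "C1 \<ge> 0" "C2 \<ge> 0"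
      "\<And>x. norm (F x) \<le> C1 * (\<Prod>i\<in>I. 1 + cmod (x i)) ^ N1"
      "\<And>x. norm (G x) \<le> C2 * (\<Prod>i\<in>I. 1 + cmod (x i)) ^ N2"
    using assms unfolding poly_growth_def by metis
  have "norm (F x * G x) \<le> (C1 * C2) * (\<Prod>i\<in>I. 1 + cmod (x i)) ^ (N1 + N2)" for x
    using mult_mono[OF *(3,4)[of x]] *(1) prod_one_plus_ge_1[of x I]
    by (simp add: norm_mult power_add mult_ac)
  then show ?thesis
    using assms *(1,2) unfolding poly_growth_def by (auto intro!: exI[of _ "C1 * C2"])
qed

lemma poly_growth_add:
  assumes "poly_growth I F" "poly_growth I G"
  shows "poly_growth I (\<lambda>x. F x + G x)"
proof -
  obtain C1 N1 C2 N2 where *: "C1 \<ge> 0" "C2 \<ge> 0"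
      "\<And>x. norm (F x) \<le> C1 * (\<Prod>i\<in>I. 1 + cmod (x i)) ^ N1"
      "\<And>x. norm (G x) \<le> C2 * (\<Prod>i\<in>I. 1 + cmod (x i)) ^ N2"
    using assms unfolding poly_growth_def by metis
  have "norm (F x + G x) \<le> (C1 + C2) * (\<Prod>i\<in>I. 1 + cmod (x i)) ^ (N1 + N2)" for x
  proof -
    let ?P = "\<Prod>i\<in>I. 1 + cmod (x i)"
    have "?P ^ N1 \<le> ?P ^ (N1 + N2)" "?P ^ N2 \<le> ?P ^ (N1 + N2)"
      by (intro power_increasing prod_one_plus_ge_1; simp)+
    then have "C1 * ?P ^ N1 + C2 * ?P ^ N2 \<le> (C1 + C2) * ?P ^ (N1 + N2)"
      using *(1,2) by (simp add: distrib_right add_mono mult_left_mono)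
    then show ?thesis using norm_triangle_ineq[of "F x" "G x"] *(3,4)[of x] by linarith
  qed
  then show ?thesis
    using assms *(1,2) unfolding poly_growth_def by (auto intro!: exI[of _ "C1 + C2"])
qed

lemma poly_growth_diff:
  assumes "poly_growth I F" "poly_growth I G"
  shows "poly_growth I (\<lambda>x. F x - G x)"
  using poly_growth_add[OF assms(1) poly_growth_mult[OF poly_growth_const[of I "-1"] assms(2)]]
  by simp

lemma poly_growth_sum:
  assumes "\<And>k. k \<in> K \<Longrightarrow> poly_growth I (F k)"
  shows "poly_growth I (\<lambda>x. \<Sum>k\<in>K. F k x)"
  using assms by (induction K rule: infinite_finite_induct)
    (auto intro: poly_growth_add poly_growth_mult poly_growth_const)

lemma poly_growth_prod:
  assumes "\<And>k. k \<in> K \<Longrightarrow> poly_growth I (F k)"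
  shows "poly_growth I (\<lambda>x. \<Prod>k\<in>K. F k x)"
  using assms by (induction K rule: infinite_finite_induct)
    (auto intro: poly_growth_add poly_growth_mult poly_growth_const)

lemma poly_growth_power:
  assumes "poly_growth I F"
  shows "poly_growth I (\<lambda>x. F x ^ k)"
  using assms by (induction k) (auto intro: poly_growth_mult poly_growth_const)

lemma poly_growth_norm:
  assumes "poly_growth I F"
  shows "poly_growth I (\<lambda>x. norm (F x))"
  using assms unfolding poly_growth_def by auto

lemma poly_growth_of_real:
  assumes "poly_growth I F"
  shows "poly_growth I (\<lambda>x. of_real (F x))"
  using assms unfolding poly_growth_def by auto

lemma borel_measurable_cnj [measurable]: "cnj \<in> borel_measurable borel"
  by (intro borel_measurable_continuous_onI continuous_intros)

lemma poly_growth_cnj: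
  assumes "poly_growth I F"
  shows "poly_growth I (\<lambda>x. cnj (F x))"
  using assms unfolding poly_growth_def by auto

lemma poly_growth_vdm: "finite I \<Longrightarrow> K \<subseteq> I \<Longrightarrow> poly_growth I (vdm K)"
  unfolding vdm_def by (intro poly_growth_prod poly_growth_norm poly_growth_diff poly_growth_component) auto

lemma poly_growth_node_poly:
  "finite I \<Longrightarrow> K \<subseteq> I \<Longrightarrow> poly_growth I g \<Longrightarrow> poly_growth I (\<lambda>x. node_poly K x (g x))"
  unfolding node_poly_def by (intro poly_growth_prod poly_growth_diff poly_growth_component) auto

lemmas poly_growth_intros = poly_growth_const poly_growth_component poly_growth_mult poly_growth_add
  poly_growth_diff poly_growth_sum poly_growth_prod poly_growth_power poly_growth_norm
  poly_growth_of_real poly_growth_cnj poly_growth_vdm poly_growth_node_poly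

lemma power_times_cnj_power: "z ^ n * cnj z ^ n = of_real (cmod z ^ (2 * n))"
proof -
  have "z ^ n * cnj z ^ n = (z * cnj z) ^ n" by (simp add: power_mult_distrib)
  also have "\<dots> = of_real ((cmod z)\<^sup>2) ^ n" by (simp only: complex_norm_square)
  finally show ?thesis by (simp add: power_mult)
qed

section \<open>Vandermonde integrals against a weight with finite moments\<close>

locale moment_weight =
  fixes w :: "complex \<Rightarrow> real"
  assumes measurable_w [measurable]: "w \<in> borel_measurable borel"
    and w_nonneg: "\<And>z. 0 \<le> w z"
    and moments: "\<And>k. integrable lborel (\<lambda>z. cmod z ^ k * w z)"
begin

definition mom :: "nat \<Rightarrow> real" where
  "mom k = (\<integral>z. cmod z ^ (2 * k) * w z \<partial>lborel)"

definition wprod :: "nat set \<Rightarrow> (nat \<Rightarrow> complex) \<Rightarrow> real" where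
  "wprod I x = (\<Prod>i\<in>I. w (x i))"

definition Zint :: "nat set \<Rightarrow> real" where
  "Zint I = (\<integral>x. vdm I x * wprod I x \<partial>lborel_on I)"

lemma mom_nonneg: "0 \<le> mom k"
  unfolding mom_def using w_nonneg by (intro Bochner_Integration.integral_nonneg) auto

lemma wprod_nonneg: "0 \<le> wprod I x"
  unfolding wprod_def using w_nonneg by (intro prod_nonneg) auto

lemma measurable_wprod [measurable]: "wprod I \<in> borel_measurable (lborel_on I)"
  unfolding wprod_def by measurable

lemma wprod_insert:
  "finite J \<Longrightarrow> k \<notin> J \<Longrightarrow> wprod (insert k J) (x(k := y)) = wprod J x * w y"
  unfolding wprod_def by (auto simp: mult.commute intro!: prod.cong)

lemma integrable_one_plus_power: "integrable lborel (\<lambda>z. (1 + cmod z) ^ N * w z)"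
proof -
  have "(\<lambda>z. (1 + cmod z) ^ N * w z) = (\<lambda>z. \<Sum>k\<le>N. real (N choose k) * (cmod z ^ k * w z))"
    by (rule ext) (simp add: add.commute[of 1] binomial_ring sum_distrib_right sum_distrib_left mult_ac)
  then show ?thesis using moments by simp
qed

lemma integrable_poly_growth:
  fixes F :: "(nat \<Rightarrow> complex) \<Rightarrow> 'b::{real_normed_field, banach, second_countable_topology}"
  assumes I: "finite I" and F: "poly_growth I F"
  shows "integrable (lborel_on I) (\<lambda>x. F x * of_real (wprod I x))"
proof -
  obtain C N where *: "C \<ge> 0" "\<And>x. norm (F x) \<le> C * (\<Prod>i\<in>I. 1 + cmod (x i)) ^ N"
    using F unfolding poly_growth_def by metis
  have [measurable]: "F \<in> borel_measurable (lborel_on I)" by (rule poly_growthD[OF F])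
  show ?thesis
  proof (rule Bochner_Integration.integrable_bound)
    show "integrable (lborel_on I) (\<lambda>x. C * (\<Prod>i\<in>I. (1 + cmod (x i)) ^ N * w (x i)))"
      using I integrable_one_plus_power
      by (intro integrable_mult_right lborel_product.product_integrable_prod) auto
    show "AE x in lborel_on I. norm (F x * of_real (wprod I x))
        \<le> norm (C * (\<Prod>i\<in>I. (1 + cmod (x i)) ^ N * w (x i)))"
    proof (rule AE_I2)
      fix x
      have "norm (F x * of_real (wprod I x)) \<le> C * (\<Prod>i\<in>I. 1 + cmod (x i)) ^ N * wprod I x"
        using *(2)[of x] wprod_nonneg[of I x] by (simp add: norm_mult mult_right_mono)
      also have "\<dots> = C * (\<Prod>i\<in>I. (1 + cmod (x i)) ^ N * w (x i))"
        by (simp add: prod.distrib wprod_def prod_power_distrib)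
      finally show "norm (F x * of_real (wprod I x))
        \<le> norm (C * (\<Prod>i\<in>I. (1 + cmod (x i)) ^ N * w (x i)))" by simp
    qed
  qed measurable
qed

lemma integrable_poly_growth_real:
  fixes F :: "(nat \<Rightarrow> complex) \<Rightarrow> real"
  assumes "finite I" "poly_growth I F"
  shows "integrable (lborel_on I) (\<lambda>x. F x * wprod I x)"
  using integrable_poly_growth[OF assms] by simp

lemma integral_insert:
  fixes F :: "(nat \<Rightarrow> complex) \<Rightarrow> complex"
  assumes J: "finite J" "k \<notin> J" and F: "poly_growth (insert k J) F"
  shows "(\<integral>x. F x * of_real (wprod (insert k J) x) \<partial>lborel_on (insert k J))
    = (\<integral>x. (\<integral>y. F (x(k := y)) * of_real (w y) \<partial>lborel) * of_real (wprod J x) \<partial>lborel_on J)"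
proof -
  have "(\<integral>x. F x * of_real (wprod (insert k J) x) \<partial>lborel_on (insert k J))
    = (\<integral>x. (\<integral>y. F (x(k := y)) * of_real (wprod (insert k J) (x(k := y))) \<partial>lborel) \<partial>lborel_on J)"
    using J F by (intro lborel_product.product_integral_insert integrable_poly_growth) auto
  also have "\<dots> = (\<integral>x. (\<integral>y. F (x(k := y)) * of_real (w y) * of_real (wprod J x) \<partial>lborel) \<partial>lborel_on J)"
    using J by (simp add: wprod_insert mult_ac)
  finally show ?thesis by simp
qed

text \<open>The inner product, in the L^2 space of the weight, of \<open>y ^ n\<close> and the
  polynomial with roots \<open>x j\<close>. It is what a term of \<open>vdm_expand\<close> leaves
  behind once its distinguished variable is integrated out.\<close>

definition inner_node :: "nat \<Rightarrow> nat set \<Rightarrow> (nat \<Rightarrow> complex) \<Rightarrow> complex" where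
  "inner_node n K x = (\<integral>y. y ^ n * cnj (node_poly K x y) * of_real (w y) \<partial>lborel)"

lemma cmod_node_poly_le:
  "cmod (node_poly K x y) \<le> (1 + cmod y) ^ card K * (\<Prod>i\<in>K. 1 + cmod (x i))"
proof -
  have "cmod (y - x j) \<le> (1 + cmod y) * (1 + cmod (x j))" for j
  proof -
    have "0 \<le> cmod y * cmod (x j)" by simp
    moreover have "(1 + cmod y) * (1 + cmod (x j)) = 1 + cmod y + cmod (x j) + cmod y * cmod (x j)"
      by (simp add: algebra_simps)
    ultimately show ?thesis using norm_triangle_ineq4[of y "x j"] by linarith
  qed
  then have "cmod (node_poly K x y) \<le> (\<Prod>j\<in>K. (1 + cmod y) * (1 + cmod (x j)))"
    unfolding node_poly_def prod_norm[symmetric] by (intro prod_mono) auto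
  then show ?thesis by (simp add: prod.distrib)
qed

lemma inner_node_bound:
  "cmod (y ^ n * cnj (node_poly K x y) * of_real (w y))
    \<le> (\<Prod>i\<in>K. 1 + cmod (x i)) * ((1 + cmod y) ^ (n + card K) * w y)"
proof -
  have "cmod y ^ n * cmod (node_poly K x y)
      \<le> (1 + cmod y) ^ n * ((1 + cmod y) ^ card K * (\<Prod>i\<in>K. 1 + cmod (x i)))"
    using cmod_node_poly_le[of K x y] by (intro mult_mono power_mono) auto
  from mult_right_mono[OF this w_nonneg[of y]] show ?thesis
    using w_nonneg[of y] by (simp add: norm_mult norm_power power_add mult_ac)
qed

lemma measurable_node_poly [measurable]:
  "(\<lambda>y. node_poly K x y) \<in> borel_measurable borel"
  unfolding node_poly_def by measurable

lemma inner_node_integrable: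
  "integrable lborel (\<lambda>y. y ^ n * cnj (node_poly K x y) * of_real (w y))"
proof (rule Bochner_Integration.integrable_bound)
  show "integrable lborel (\<lambda>y. (\<Prod>i\<in>K. 1 + cmod (x i)) * ((1 + cmod y) ^ (n + card K) * w y))"
    by (intro integrable_mult_right integrable_one_plus_power)
  show "AE y in lborel. norm (y ^ n * cnj (node_poly K x y) * of_real (w y))
     \<le> norm ((\<Prod>i\<in>K. 1 + cmod (x i)) * ((1 + cmod y) ^ (n + card K) * w y))"
    by (intro AE_I2 order.trans[OF inner_node_bound]) auto
qed measurable

lemma inner_node_growth:
  assumes I: "finite I" "K \<subseteq> I"
  shows "poly_growth I (inner_node n K)"
  unfolding poly_growth_def
proof
  have "(\<lambda>(x, y). node_poly K x y) \<in> borel_measurable (lborel_on I \<Otimes>\<^sub>M lborel)"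
    unfolding node_poly_def split_beta'
  proof (intro borel_measurable_prod borel_measurable_diff)
    fix j assume j: "j \<in> K"
    with I have "j \<in> I" by auto
    then have [measurable]: "(\<lambda>x. x j) \<in> borel_measurable (lborel_on I)"
      by measurable
    show "(\<lambda>p. fst p j) \<in> borel_measurable (lborel_on I \<Otimes>\<^sub>M (lborel :: complex measure))"
      by measurable
  qed measurable
  then have [measurable]: "(\<lambda>p. node_poly K (fst p) (snd p)) \<in> borel_measurable (lborel_on I \<Otimes>\<^sub>M lborel)"
    by (simp add: split_beta')
  have "(\<lambda>(x, y). y ^ n * cnj (node_poly K x y) * of_real (w y))
      \<in> borel_measurable (lborel_on I \<Otimes>\<^sub>M lborel)"
    unfolding split_beta' by measurable
  then show "inner_node n K \<in> borel_measurable (lborel_on I)"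
    unfolding inner_node_def[abs_def] by (rule lborel.borel_measurable_lebesgue_integral)
  define C where "C = (\<integral>y. (1 + cmod y) ^ (n + card K) * w y \<partial>lborel)"
  have C: "C \<ge> 0" unfolding C_def using w_nonneg by (intro Bochner_Integration.integral_nonneg) auto
  have "cmod (inner_node n K x) \<le> C * (\<Prod>i\<in>I. 1 + cmod (x i)) ^ 1" for x
  proof -
    have "cmod (inner_node n K x)
        \<le> (\<integral>y. (\<Prod>i\<in>K. 1 + cmod (x i)) * ((1 + cmod y) ^ (n + card K) * w y) \<partial>lborel)"
      unfolding inner_node_def
      by (rule order.trans[OF integral_norm_bound integral_mono])
        (use inner_node_integrable integrable_one_plus_power inner_node_bound in auto)
    also have "\<dots> = (\<Prod>i\<in>K. 1 + cmod (x i)) * C"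
      by (simp add: C_def)
    also have "\<dots> \<le> (\<Prod>i\<in>I. 1 + cmod (x i)) * C"
      using I C by (intro mult_right_mono prod_mono2) auto
    finally show ?thesis by (simp add: mult_ac)
  qed
  then show "\<exists>C\<ge>0. \<exists>N. \<forall>x. cmod (inner_node n K x) \<le> C * (\<Prod>i\<in>I. 1 + cmod (x i)) ^ N"
    using C by blast
qed

lemma inner_node_cong: "(\<And>j. j \<in> K \<Longrightarrow> x j = y j) \<Longrightarrow> inner_node n K x = inner_node n K y"
  unfolding inner_node_def by (simp add: node_poly_cong[of K x y])

text \<open>In the k-th term of \<open>vdm_expand\<close> the factor \<open>vdm (I - {k}) x\<close>
  does not involve \<open>x k\<close>, so integrating \<open>x k\<close> first leaves
  \<open>inner_node\<close>.\<close>

lemma Zint_recursion: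
  assumes I: "finite I" "card I = Suc n"
  shows "of_real (Zint I) = (\<Sum>k\<in>I. \<integral>x. of_real (vdm (I - {k}) x) * inner_node n (I - {k}) x
            * of_real (wprod (I - {k}) x) \<partial>lborel_on (I - {k}))"
proof -
  let ?F = "\<lambda>k x. of_real (vdm (I - {k}) x) * x k ^ n * cnj (node_poly (I - {k}) x (x k))"
  have pg: "poly_growth I (?F k)" if "k \<in> I" for k
    using I that by (intro poly_growth_intros) auto
  have "complex_of_real (Zint I) = (\<integral>x. of_real (vdm I x) * of_real (wprod I x) \<partial>lborel_on I)"
    unfolding Zint_def by (simp flip: of_real_mult)
  also have "\<dots> = (\<integral>x. (\<Sum>k\<in>I. ?F k x * of_real (wprod I x)) \<partial>lborel_on I)"
    by (simp add: vdm_expand[OF I] sum_distrib_right)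
  also have "\<dots> = (\<Sum>k\<in>I. \<integral>x. ?F k x * of_real (wprod I x) \<partial>lborel_on I)"
    using integrable_poly_growth[OF I(1) pg] by (intro Bochner_Integration.integral_sum) auto
  also have "\<dots> = (\<Sum>k\<in>I. \<integral>x. of_real (vdm (I - {k}) x) * inner_node n (I - {k}) x
            * of_real (wprod (I - {k}) x) \<partial>lborel_on (I - {k}))"
  proof (rule sum.cong)
    fix k assume k: "k \<in> I"
    define J where "J = I - {k}"
    have J: "finite J" "k \<notin> J" "I = insert k J" using I k by (auto simp: J_def)
    have e: "?F k (x(k := y)) = of_real (vdm J x) * (y ^ n * cnj (node_poly J x y))" for x y
    proof -
      have "vdm J (x(k := y)) = vdm J x"
        using J by (intro vdm_cong) auto
      moreover have "node_poly J (x(k := y)) y = node_poly J x y"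
        using J by (intro node_poly_cong) auto
      ultimately show ?thesis by (simp add: J_def[symmetric] mult_ac)
    qed
    have "(\<integral>x. ?F k x * of_real (wprod I x) \<partial>lborel_on I)
      = (\<integral>x. (\<integral>y. ?F k (x(k := y)) * of_real (w y) \<partial>lborel) * of_real (wprod J x) \<partial>lborel_on J)"
      by (rule integral_insert[OF J(1,2), of "?F k", folded J(3), OF pg[OF k]])
    also have "\<dots> = (\<integral>x. of_real (vdm J x) * inner_node n J x * of_real (wprod J x) \<partial>lborel_on J)"
      unfolding e inner_node_def by (simp add: mult.assoc)
    finally show "(\<integral>x. ?F k x * of_real (wprod I x) \<partial>lborel_on I)
       = (\<integral>x. of_real (vdm (I - {k}) x) * inner_node n (I - {k}) x
            * of_real (wprod (I - {k}) x) \<partial>lborel_on (I - {k}))" unfolding J_def .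
  qed simp
  finally show ?thesis .
qed

text \<open>A second Lagrange expansion, now of the conjugated polynomial: its top power meets
  \<open>y ^ n\<close> and yields the moment, and the lower terms become the cross terms.\<close>

lemma inner_node_vdm:
  assumes J: "finite J" and n: "n = card J"
  shows "of_real (vdm J x) * inner_node n J x = of_real (vdm J x) * of_real (mom n)
     - (\<Sum>l\<in>J. of_real (vdm (J - {l}) x) * cnj (x l ^ n) * node_poly (J - {l}) x (x l)
            * inner_node n (J - {l}) x)"
proof -
  let ?c = "\<lambda>l. of_real (vdm (J - {l}) x) * cnj (x l ^ n) * node_poly (J - {l}) x (x l)"
  let ?g = "\<lambda>l y. y ^ n * cnj (node_poly (J - {l}) x y) * of_real (w y)"
  have m: "of_real (cmod y ^ (2 * n) * w y) = y ^ n * cnj y ^ n * of_real (w y)" for y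
    by (simp only: power_times_cnj_power of_real_mult)
  have "of_real (vdm J x) * inner_node n J x
      = (\<integral>y. y ^ n * (of_real (vdm J x) * cnj (node_poly J x y)) * of_real (w y) \<partial>lborel)"
    unfolding inner_node_def by (simp add: mult_ac flip: integral_mult_right_zero)
  also have "\<dots> = (\<integral>y. of_real (vdm J x) * of_real (cmod y ^ (2 * n) * w y)
         - (\<Sum>l\<in>J. ?c l * ?g l y) \<partial>lborel)"
    unfolding vdm_mult_cnj_node_poly[OF J] n[symmetric] m
    by (intro Bochner_Integration.integral_cong refl)
      (simp add: right_diff_distrib left_diff_distrib sum_distrib_left sum_distrib_right mult_ac)
  also have "\<dots> = (\<integral>y. of_real (vdm J x) * of_real (cmod y ^ (2 * n) * w y) \<partial>lborel)
         - (\<Sum>l\<in>J. ?c l * (\<integral>y. ?g l y \<partial>lborel))"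
    using moments[of "2 * n"] inner_node_integrable
    by (subst Bochner_Integration.integral_diff)
      (auto intro!: integrable_of_real integrable_mult_right Bochner_Integration.integrable_sum
        simp: Bochner_Integration.integral_sum simp del: of_real_mult of_real_power)
  also have "(\<integral>y. of_real (vdm J x) * of_real (cmod y ^ (2 * n) * w y) \<partial>lborel)
      = complex_of_real (vdm J x) * of_real (mom n)"
    unfolding mom_def by (simp del: of_real_mult of_real_power)
  finally show ?thesis unfolding inner_node_def .
qed

text \<open>The variable \<open>x l\<close> enters only through the conjugate of the integrand that
  defines \<open>inner_node n (J - {l}) x\<close>. Integrating it first completes a squared modulus
  against a nonnegative weight.\<close>

lemma cross_term_nonneg:
  assumes J: "finite J" and l: "l \<in> J"
  shows "0 \<le> Re (\<integral>x. of_real (vdm (J - {l}) x) * cnj (x l ^ n) * node_poly (J - {l}) x (x l)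
            * inner_node n (J - {l}) x * of_real (wprod J x) \<partial>lborel_on J)"
proof -
  define K where "K = J - {l}"
  have K: "finite K" "l \<notin> K" "J = insert l K" using J l by (auto simp: K_def)
  let ?F = "\<lambda>x. of_real (vdm K x) * cnj (x l ^ n) * node_poly K x (x l) * inner_node n K x"
  have pg: "poly_growth (insert l K) ?F"
    using K(1) by (intro poly_growth_intros inner_node_growth) auto
  have e: "?F (x(l := y)) * of_real (w y) = (of_real (vdm K x) * inner_node n K x)
      * cnj (y ^ n * cnj (node_poly K x y) * of_real (w y))" for x y
  proof -
    have "vdm K (x(l := y)) = vdm K x"
      using K by (intro vdm_cong) auto
    moreover have "node_poly K (x(l := y)) y = node_poly K x y"
      using K by (intro node_poly_cong) auto
    moreover have "inner_node n K (x(l := y)) = inner_node n K x"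
      using K by (intro inner_node_cong) auto
    ultimately show ?thesis by (simp add: mult_ac)
  qed
  have "(\<integral>x. ?F x * of_real (wprod J x) \<partial>lborel_on J)
      = (\<integral>x. (\<integral>y. ?F (x(l := y)) * of_real (w y) \<partial>lborel) * of_real (wprod K x) \<partial>lborel_on K)"
    unfolding K(3) by (rule integral_insert[OF K(1,2) pg])
  also have "\<dots> = (\<integral>x. of_real (vdm K x * (cmod (inner_node n K x))\<^sup>2 * wprod K x) \<partial>lborel_on K)"
  proof (intro Bochner_Integration.integral_cong refl)
    fix x
    have "(\<integral>y. ?F (x(l := y)) * of_real (w y) \<partial>lborel)
        = of_real (vdm K x) * inner_node n K x * cnj (inner_node n K x)"
      unfolding e inner_node_def[of n K x]
      by (simp only: integral_mult_right_zero Bochner_Integration.integral_cnj)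
    also have "\<dots> = of_real (vdm K x) * of_real ((cmod (inner_node n K x))\<^sup>2)"
      by (simp only: complex_norm_square mult.assoc)
    finally show "(\<integral>y. ?F (x(l := y)) * of_real (w y) \<partial>lborel) * of_real (wprod K x)
        = of_real (vdm K x * (cmod (inner_node n K x))\<^sup>2 * wprod K x)"
      by simp
  qed
  also have "Re \<dots> = (\<integral>x. vdm K x * (cmod (inner_node n K x))\<^sup>2 * wprod K x \<partial>lborel_on K)"
    by (simp del: of_real_mult of_real_power)
  also have "\<dots> \<ge> 0"
    using vdm_nonneg wprod_nonneg by (intro Bochner_Integration.integral_nonneg) auto
  finally show ?thesis unfolding K_def .
qed

text \<open>Fischer's inequality for Gram determinants, without determinants: the lower terms of the
  Lagrange expansion integrate to minus a square, and they vanish for radial weights.\<close>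

lemma Zint_Fischer:
  assumes I: "finite I" "card I = Suc n"
  shows "Zint I \<le> (\<Sum>k\<in>I. Zint (I - {k})) * mom n"
proof -
  have "Re (\<integral>x. of_real (vdm J x) * inner_node n J x * of_real (wprod J x) \<partial>lborel_on J)
      \<le> Zint J * mom n" (is "Re ?L \<le> _") if k: "k \<in> I" and J_def: "J = I - {k}" for k J
  proof -
    have J: "finite J" "n = card J" using I k by (auto simp: J_def)
    let ?c = "\<lambda>l x. of_real (vdm (J - {l}) x) * cnj (x l ^ n) * node_poly (J - {l}) x (x l)
            * inner_node n (J - {l}) x"
    have pg: "poly_growth J (?c l)" if "l \<in> J" for l
      using J that by (intro poly_growth_intros inner_node_growth) auto
    have ic: "integrable (lborel_on J) (\<lambda>x. ?c l x * of_real (wprod J x))" if "l \<in> J" for l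
      by (rule integrable_poly_growth[OF J(1) pg[OF that]])
    have i0: "integrable (lborel_on J)
        (\<lambda>x. of_real (vdm J x) * complex_of_real (mom n) * of_real (wprod J x))"
      using J(1) by (intro integrable_poly_growth poly_growth_intros) auto
    have "?L = (\<integral>x. of_real (vdm J x) * of_real (mom n) * of_real (wprod J x)
          - (\<Sum>l\<in>J. ?c l x * of_real (wprod J x)) \<partial>lborel_on J)"
      unfolding inner_node_vdm[OF J] by (simp add: left_diff_distrib sum_distrib_right)
    also have "\<dots> = (\<integral>x. of_real (vdm J x) * of_real (mom n) * of_real (wprod J x) \<partial>lborel_on J)
          - (\<Sum>l\<in>J. \<integral>x. ?c l x * of_real (wprod J x) \<partial>lborel_on J)"
      using ic i0
      by (simp only: Bochner_Integration.integral_diff[OF i0 Bochner_Integration.integrable_sum[OF ic]]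
          Bochner_Integration.integral_sum[OF ic])
    also have "(\<integral>x. of_real (vdm J x) * of_real (mom n) * of_real (wprod J x) \<partial>lborel_on J)
        = (\<integral>x. complex_of_real (mom n) * of_real (vdm J x * wprod J x) \<partial>lborel_on J)"
      by (simp add: mult_ac)
    also have "\<dots> = of_real (mom n * Zint J)"
      unfolding Zint_def by (simp del: of_real_mult add: of_real_mult[of "mom n"])
    finally have "Re ?L = mom n * Zint J
        - (\<Sum>l\<in>J. Re (\<integral>x. ?c l x * of_real (wprod J x) \<partial>lborel_on J))"
      by simp
    moreover have "0 \<le> (\<Sum>l\<in>J. Re (\<integral>x. ?c l x * of_real (wprod J x) \<partial>lborel_on J))"
      using J(1) by (intro sum_nonneg cross_term_nonneg)
    ultimately show ?thesis by (simp add: mult.commute)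
  qed
  moreover have "Zint I = Re (of_real (Zint I))" by simp
  ultimately show ?thesis
    unfolding Zint_recursion[OF I] by (auto simp: sum_distrib_right intro!: sum_mono)
qed

lemma Zint_empty: "Zint {} = 1"
  unfolding Zint_def vdm_def wprod_def
  using lborel_product.product_integral_prod[of "{}" "\<lambda>_ _. 1::real"] by simp

lemma Zint_le:
  assumes "finite I"
  shows "Zint I \<le> fact (card I) * (\<Prod>j<card I. mom j)"
  using assms
proof (induction "card I" arbitrary: I)
  case 0
  then show ?case by (simp add: Zint_empty)
next
  case (Suc n)
  have "Zint I \<le> (\<Sum>k\<in>I. Zint (I - {k})) * mom n"
    using Suc by (intro Zint_Fischer) auto
  also have "\<dots> \<le> (\<Sum>k\<in>I. fact n * (\<Prod>j<n. mom j)) * mom n"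
  proof (intro mult_right_mono sum_mono mom_nonneg)
    fix k assume "k \<in> I"
    then have "n = card (I - {k})" using Suc(2,3) by simp
    then show "Zint (I - {k}) \<le> fact n * (\<Prod>j<n. mom j)"
      using Suc(1)[of "I - {k}"] Suc(3) by auto
  qed
  finally show ?case by (simp add: Suc(2)[symmetric] algebra_simps)
qed

end

section \<open>Radial weights: orthogonal monomials and the exact product formula\<close>

locale radial_weight = moment_weight +
  assumes radial: "\<And>u z. cmod u = 1 \<Longrightarrow> w (u * z) = w z"
begin

lemma integral_power_cnj_power:
  "(\<integral>z. z ^ a * cnj (z ^ b) * of_real (w z) \<partial>lborel) = (if a = b then of_real (mom a) else 0)"
proof (cases "a = b")
  case True
  have "z ^ b * cnj (z ^ b) * of_real (w z) = of_real (cmod z ^ (2 * b) * w z)" for z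
    by (simp only: complex_cnj_power power_times_cnj_power of_real_mult)
  then show ?thesis unfolding mom_def True by (simp del: of_real_mult of_real_power)
qed (use integral_power_cnj_power_radial_eq_0[of w a b] measurable_w radial in auto)

lemma integrable_power_cnj_power:
  "integrable lborel (\<lambda>z. z ^ a * cnj (z ^ b) * of_real (w z))"
  by (rule Bochner_Integration.integrable_bound[OF moments[of "a + b"]])
    (auto simp: norm_mult norm_power power_add w_nonneg)

text \<open>Distinct monomials are orthogonal, so only the leading term of the node polynomial, with
  coefficient 1, meets \<open>y ^ card J\<close>. The nodes drop out, and the recursion for
  \<open>Zint\<close> closes exactly.\<close>

lemma inner_node_radial:
  assumes J: "finite J"
  shows "inner_node (card J) J x = of_real (mom (card J))"
proof -
  define P where "P = (\<Prod>j\<in>J. [:- x j, 1:])"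
  have P: "degree P = card J" "coeff P (card J) = 1"
    using coeff_prod_linear_card[OF J] by (simp_all add: P_def)
  have "inner_node (card J) J x = (\<integral>y. (\<Sum>i\<le>card J. cnj (coeff P i) *
       (y ^ card J * cnj (y ^ i) * of_real (w y))) \<partial>lborel)"
    unfolding inner_node_def node_poly_eq_poly P_def[symmetric]
    by (intro Bochner_Integration.integral_cong refl)
      (simp add: poly_altdef P sum_distrib_left sum_distrib_right mult_ac)
  also have "\<dots> = (\<Sum>i\<le>card J. cnj (coeff P i) *
       (\<integral>y. y ^ card J * cnj (y ^ i) * of_real (w y) \<partial>lborel))"
    using integrable_power_cnj_power
    by (subst Bochner_Integration.integral_sum) auto
  also have "\<dots> = of_real (mom (card J))"
    by (simp add: integral_power_cnj_power P if_distrib[of "\<lambda>t. _ * t"] del: complex_cnj_power cong: if_cong)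
  finally show ?thesis .
qed

lemma Zint_eq:
  assumes "finite I"
  shows "Zint I = fact (card I) * (\<Prod>j<card I. mom j)"
  using assms
proof (induction "card I" arbitrary: I)
  case 0
  then show ?case by (simp add: Zint_empty)
next
  case (Suc n)
  have "complex_of_real (Zint I) = (\<Sum>k\<in>I. of_real (fact n * (\<Prod>j<n. mom j) * mom n))"
    unfolding Zint_recursion[OF Suc(3) Suc(2)[symmetric]]
  proof (rule sum.cong)
    fix k assume k: "k \<in> I"
    define J where "J = I - {k}"
    have J: "finite J" "n = card J" using Suc(2,3) k by (auto simp: J_def)
    have "(\<integral>x. of_real (vdm J x) * inner_node n J x * of_real (wprod J x) \<partial>lborel_on J)
       = (\<integral>x. complex_of_real (mom n) * of_real (vdm J x * wprod J x) \<partial>lborel_on J)"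
      using inner_node_radial[OF J(1)] J(2) by (simp add: mult_ac)
    also have "\<dots> = of_real (mom n * Zint J)"
      unfolding Zint_def by (simp del: of_real_mult add: of_real_mult[of "mom n"])
    also have "Zint J = fact n * (\<Prod>j<n. mom j)"
      using Suc(1)[OF J(2,1)] J(2) by simp
    finally show "(\<integral>x. of_real (vdm (I - {k}) x) * inner_node n (I - {k}) x
            * of_real (wprod (I - {k}) x) \<partial>lborel_on (I - {k}))
       = of_real (fact n * (\<Prod>j<n. mom j) * mom n)"
      by (simp add: J_def mult.commute)
  qed simp
  also have "\<dots> = of_real (fact (Suc n) * (\<Prod>j<Suc n. mom j))"
    by (simp add: Suc(2)[symmetric] algebra_simps)
  finally show ?case unfolding of_real_eq_iff Suc(2) .
qed

end

section \<open>The Ginibre ensemble and its spectral radius\<close>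

declare One_nat_def [simp del]

context moment_weight begin

lemma nn_integral_vdm_wprod:
  assumes "finite I"
  shows "(\<integral>\<^sup>+x. ennreal (vdm I x * wprod I x) \<partial>lborel_on I) = ennreal (Zint I)"
  unfolding Zint_def
  using assms vdm_nonneg wprod_nonneg
  by (intro nn_integral_eq_integral integrable_poly_growth_real poly_growth_intros AE_I2) auto

end

section \<open>The Gaussian weight and the normalised Ginibre law\<close>

definition gauss :: "complex \<Rightarrow> real" where
  "gauss z = exp (- (cmod z)\<^sup>2)"

lemma gauss_pos: "0 < gauss z"
  by (simp add: gauss_def)

lemma measurable_gauss [measurable]: "gauss \<in> borel_measurable borel"
  unfolding gauss_def by measurable

lemma integrable_gaussian_even_moment:
  "integrable lborel (\<lambda>z. cmod z ^ (2 * k) * gauss z)"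
  using nn_integral_gaussian_moment[of 1 k]
  by (intro integrableI_nonneg AE_I2) (auto simp: gauss_def)

lemma integrable_gaussian_moment: "integrable lborel (\<lambda>z. cmod z ^ k * gauss z)"
proof (rule Bochner_Integration.integrable_bound)
  show "integrable lborel (\<lambda>z. cmod z ^ (2 * 0) * gauss z + cmod z ^ (2 * k) * gauss z)"
    by (intro Bochner_Integration.integrable_add integrable_gaussian_even_moment)
  show "AE z in lborel. norm (cmod z ^ k * gauss z)
      \<le> norm (cmod z ^ (2 * 0) * gauss z + cmod z ^ (2 * k) * gauss z)"
  proof (rule AE_I2)
    fix z
    have "cmod z ^ k \<le> 1 + cmod z ^ (2 * k)"
    proof (cases "cmod z \<le> 1")
      case True
      then have "cmod z ^ k \<le> 1" by (simp add: power_le_one)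
      then show ?thesis by (simp add: add_increasing2)
    next
      case False
      then have "cmod z ^ k \<le> cmod z ^ (2 * k)" by (intro power_increasing) auto
      then show ?thesis by simp
    qed
    then have "cmod z ^ k * gauss z \<le> (1 + cmod z ^ (2 * k)) * gauss z"
      using gauss_pos[of z] by (intro mult_right_mono) auto
    then show "norm (cmod z ^ k * gauss z)
      \<le> norm (cmod z ^ (2 * 0) * gauss z + cmod z ^ (2 * k) * gauss z)"
      using gauss_pos[of z] by (simp add: distrib_right abs_mult add_nonneg_nonneg)
  qed
qed measurable

lemma moment_weight_dominated:
  assumes [measurable]: "w \<in> borel_measurable borel"
    and w: "\<And>z. 0 \<le> w z" "\<And>z. w z \<le> C * gauss z"
  shows "moment_weight w"
proof
  fix k
  show "integrable lborel (\<lambda>z. cmod z ^ k * w z)"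
  proof (rule Bochner_Integration.integrable_bound)
    show "integrable lborel (\<lambda>z. C * (cmod z ^ k * gauss z))"
      by (intro integrable_mult_right integrable_gaussian_moment)
    show "AE z in lborel. norm (cmod z ^ k * w z) \<le> norm (C * (cmod z ^ k * gauss z))"
    proof (rule AE_I2)
      fix z
      have "cmod z ^ k * w z \<le> cmod z ^ k * (C * gauss z)"
        by (intro mult_left_mono w) auto
      also have "\<dots> \<le> norm (C * (cmod z ^ k * gauss z))"
        by (simp add: mult_ac)
      finally show "norm (cmod z ^ k * w z) \<le> norm (C * (cmod z ^ k * gauss z))"
        using w(1)[of z] by simp
    qed
  qed measurable
qed (use w in auto)

interpretation gaussian: radial_weight gauss
proof -
  interpret moment_weight gauss
    using gauss_pos by (intro moment_weight_dominated[where C = 1]) (auto intro: less_imp_le)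
  show "radial_weight gauss"
    by standard (simp add: gauss_def norm_mult)
qed

lemma gaussian_mom: "gaussian.mom k = pi * fact k"
  using nn_integral_gaussian_moment[of 1 k]
  by (simp add: gaussian.mom_def gauss_def integral_eq_nn_integral)

lemma ginibre_weight_eq: "ginibre_weight n x = vdm {1..n} x * gaussian.wprod {1..n} x"
  by (simp add: ginibre_weight_eq_vdm gaussian.wprod_def gauss_def)

lemma ginibre_weight_nonneg: "0 \<le> ginibre_weight n x"
  unfolding ginibre_weight_eq by (intro mult_nonneg_nonneg vdm_nonneg gaussian.wprod_nonneg)

lemma measurable_vdm [measurable]: "finite I \<Longrightarrow> vdm I \<in> borel_measurable (lborel_on I)"
  by (intro poly_growthD poly_growth_vdm) auto

lemma measurable_ginibre_weight [measurable]:
  "ginibre_weight n \<in> borel_measurable (lborel_on {1..n})"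
  unfolding ginibre_weight_eq[abs_def] by measurable

definition ginibre_Z :: "nat \<Rightarrow> real" where
  "ginibre_Z n = fact n * (\<Prod>j<n. pi * fact j)"

lemma ginibre_Z_pos: "0 < ginibre_Z n"
  unfolding ginibre_Z_def by (intro mult_pos_pos prod_pos) auto

lemma gaussian_Zint: "finite I \<Longrightarrow> gaussian.Zint I = ginibre_Z (card I)"
  by (simp add: gaussian.Zint_eq ginibre_Z_def gaussian_mom)

definition ginibre :: "nat \<Rightarrow> (nat \<Rightarrow> complex) measure" where
  "ginibre n = density (lborel_on {1..n}) (\<lambda>x. ennreal (ginibre_weight n x / ginibre_Z n))"

lemma sets_ginibre [measurable_cong]: "sets (ginibre n) = sets (lborel_on {1..n})"
  by (simp add: ginibre_def)

lemma space_ginibre: "space (ginibre n) = space (lborel_on {1..n})"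
  by (simp add: ginibre_def)

lemma emeasure_ginibre:
  assumes [measurable]: "A \<in> sets (lborel_on {1..n})"
  shows "emeasure (ginibre n) A
    = (\<integral>\<^sup>+x. ennreal (ginibre_weight n x) * indicator A x \<partial>lborel_on {1..n}) / ennreal (ginibre_Z n)"
proof -
  have m: "(\<lambda>x. ennreal (ginibre_weight n x / ginibre_Z n)) \<in> borel_measurable (lborel_on {1..n})"
    by measurable
  have "emeasure (ginibre n) A
    = (\<integral>\<^sup>+x. (ennreal (ginibre_weight n x) * indicator A x) / ennreal (ginibre_Z n) \<partial>lborel_on {1..n})"
    unfolding ginibre_def emeasure_density[OF m assms]
    by (intro nn_integral_cong)
      (simp add: divide_ennreal[symmetric] ginibre_weight_nonneg ginibre_Z_pos indicator_def)
  then show ?thesis by (simp add: nn_integral_divide)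
qed

interpretation ginibre: prob_space "ginibre n"
proof
  have "(\<integral>\<^sup>+x. ennreal (ginibre_weight n x) * indicator (space (lborel_on {1..n})) x \<partial>lborel_on {1..n})
      = (\<integral>\<^sup>+x. ennreal (vdm {1..n} x * gaussian.wprod {1..n} x) \<partial>lborel_on {1..n})"
    by (intro nn_integral_cong) (simp add: ginibre_weight_eq)
  then have "emeasure (ginibre n) (space (ginibre n)) = ennreal (ginibre_Z n) / ennreal (ginibre_Z n)"
    by (simp add: space_ginibre emeasure_ginibre gaussian_Zint gaussian.nn_integral_vdm_wprod)
  also have "\<dots> = 1"
    using ginibre_Z_pos[of n] by (simp add: divide_ennreal)
  finally show "emeasure (ginibre n) (space (ginibre n)) = 1" .
qed

text \<open>Total mass 1 forces the unknown constant to be the reciprocal of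
  \<open>ginibre_Z n\<close>. All estimates can then be made for the one concrete measure
  \<open>ginibre n\<close>.\<close>

lemma distr_ginibre_vector:
  assumes "prob_space M" "ginibre_vector M n lam"
  shows "distr M (lborel_on {1..n}) (\<lambda>\<omega>. \<lambda>k\<in>{1..n}. lam k \<omega>) = ginibre n"
    and "(\<lambda>\<omega>. \<lambda>k\<in>{1..n}. lam k \<omega>) \<in> M \<rightarrow>\<^sub>M lborel_on {1..n}"
proof -
  interpret M: prob_space M by fact
  let ?X = "\<lambda>\<omega>. \<lambda>k\<in>{1..n}. lam k \<omega>"
  obtain C where C: "C > 0" and
    D: "distributed M (lborel_on {1..n}) ?X (\<lambda>x. ennreal (C * ginibre_weight n x))"
    using assms(2) unfolding ginibre_vector_def by auto
  show X: "?X \<in> M \<rightarrow>\<^sub>M lborel_on {1..n}"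
    using D by (simp add: distributed_def)
  have eq: "distr M (lborel_on {1..n}) ?X
     = density (lborel_on {1..n}) (\<lambda>x. ennreal (C * ginibre_weight n x))"
    using D by (simp add: distributed_def)
  interpret D: prob_space "distr M (lborel_on {1..n}) ?X"
    by (rule M.prob_space_distr[OF X])
  have "1 = emeasure (density (lborel_on {1..n}) (\<lambda>x. ennreal (C * ginibre_weight n x)))
       (space (lborel_on {1..n}))"
    using D.emeasure_space_1 unfolding eq by simp
  also have "\<dots> = (\<integral>\<^sup>+x. ennreal C * ennreal (vdm {1..n} x * gaussian.wprod {1..n} x) \<partial>lborel_on {1..n})"
    using C by (subst emeasure_density)
      (auto intro!: nn_integral_cong simp: ennreal_mult' ginibre_weight_eq indicator_def)
  also have "\<dots> = ennreal C * (\<integral>\<^sup>+x. ennreal (vdm {1..n} x * gaussian.wprod {1..n} x) \<partial>lborel_on {1..n})"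
    by (rule nn_integral_cmult) measurable
  also have "\<dots> = ennreal (C * ginibre_Z n)"
    using C ginibre_Z_pos[of n]
    by (simp add: gaussian.nn_integral_vdm_wprod gaussian_Zint ennreal_mult)
  finally have "C * ginibre_Z n = 1"
    using C ginibre_Z_pos[of n] by (metis ennreal_eq_1)
  then have "C = 1 / ginibre_Z n"
    using ginibre_Z_pos[of n] by (simp add: field_simps)
  then show "distr M (lborel_on {1..n}) ?X = ginibre n"
    unfolding eq ginibre_def by simp
qed

text \<open>Markov's inequality before normalisation: \<open>f\<close> is the weight times a factor
  that is at least 1 on \<open>A\<close>, or any other majorant. It serves both the Chernoff bound
  for power sums and the inner disc.\<close>

lemma measure_ginibre_le:
  assumes [measurable]: "A \<in> sets (lborel_on {1..n})" and C: "C \<ge> 0"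
    and le: "\<And>x. x \<in> A \<Longrightarrow> ennreal (ginibre_weight n x) \<le> f x"
    and f: "(\<integral>\<^sup>+x. f x \<partial>lborel_on {1..n}) \<le> ennreal (C * ginibre_Z n)"
  shows "measure (ginibre n) A \<le> C"
proof -
  have "emeasure (ginibre n) A \<le> (\<integral>\<^sup>+x. f x \<partial>lborel_on {1..n}) / ennreal (ginibre_Z n)"
    unfolding emeasure_ginibre[OF assms(1)]
    using le by (intro divide_right_mono_ennreal nn_integral_mono) (auto simp: indicator_def)
  also have "\<dots> \<le> ennreal (C * ginibre_Z n) / ennreal (ginibre_Z n)"
    using f by (intro divide_right_mono_ennreal)
  also have "\<dots> = ennreal C"
    using C ginibre_Z_pos[of n] by (subst divide_ennreal) auto
  finally show ?thesis
    using C by (simp add: ginibre.emeasure_eq_measure)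
qed

section \<open>The truncated weight and the largest modulus\<close>

definition trunc :: "real \<Rightarrow> complex \<Rightarrow> real" where
  "trunc R z = (if cmod z \<le> R then gauss z else 0)"

lemma measurable_trunc [measurable]: "trunc R \<in> borel_measurable borel"
  unfolding trunc_def by measurable

interpretation trunc: radial_weight "trunc R" for R
proof -
  interpret moment_weight "trunc R"
    using gauss_pos by (intro moment_weight_dominated[where C = 1])
      (auto simp: trunc_def intro: less_imp_le)
  show "radial_weight (trunc R)"
    by standard (simp add: trunc_def gauss_def norm_mult)
qed

text \<open>Where |z| > R, a fraction \<tau> of the Gaussian exponent is traded for the constant
  \<open>exp (- \<tau> * R\<^sup>2)\<close>. What remains is a Gaussian moment of rate 1 - \<tau>,
  and j + 1 \<le> n lets the single power \<open>(1 - \<tau>) ^ n\<close> serve every j.\<close>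

lemma trunc_mom_ge:
  assumes \<tau>: "0 \<le> \<tau>" "\<tau> < 1" and j: "j < n" and R: "0 \<le> R"
  shows "trunc.mom R j \<ge> (1 - exp (- \<tau> * R\<^sup>2) / (1 - \<tau>) ^ n) * (pi * fact j)"
proof -
  define g where "g z = cmod z ^ (2 * j) * exp (- (1 - \<tau>) * (cmod z)\<^sup>2)" for z
  have [measurable]: "g \<in> borel_measurable borel" unfolding g_def by measurable
  have nn: "(\<integral>\<^sup>+z. ennreal (g z) \<partial>lborel) = ennreal (pi * fact j / (1 - \<tau>) ^ Suc j)"
    unfolding g_def using \<tau> by (intro nn_integral_gaussian_moment) auto
  have ig: "integrable lborel g"
    using nn by (intro integrableI_nonneg AE_I2) (auto simp: g_def)
  have "(\<integral>z. g z \<partial>lborel) = pi * fact j / (1 - \<tau>) ^ Suc j"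
    using nn \<tau> by (subst integral_eq_nn_integral) (auto simp: g_def)
  also have "\<dots> \<le> pi * fact j / (1 - \<tau>) ^ n"
    using \<tau> j by (intro divide_left_mono power_decreasing mult_pos_pos) auto
  finally have ig_le: "(\<integral>z. g z \<partial>lborel) \<le> pi * fact j / (1 - \<tau>) ^ n" .
  have pt: "cmod z ^ (2 * j) * gauss z - exp (- \<tau> * R\<^sup>2) * g z \<le> cmod z ^ (2 * j) * trunc R z" for z
  proof (cases "cmod z \<le> R")
    case True
    then show ?thesis by (simp add: trunc_def g_def)
  next
    case False
    then have "R\<^sup>2 \<le> (cmod z)\<^sup>2" using R by (intro power_mono) auto
    then have "- (cmod z)\<^sup>2 \<le> - \<tau> * R\<^sup>2 + - (1 - \<tau>) * (cmod z)\<^sup>2"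
      using \<tau> mult_left_mono[of "R\<^sup>2" "(cmod z)\<^sup>2" \<tau>] by (simp add: algebra_simps)
    then have "gauss z \<le> exp (- \<tau> * R\<^sup>2) * exp (- (1 - \<tau>) * (cmod z)\<^sup>2)"
      unfolding gauss_def exp_add[symmetric] by simp
    then have "cmod z ^ (2 * j) * gauss z
        \<le> cmod z ^ (2 * j) * (exp (- \<tau> * R\<^sup>2) * exp (- (1 - \<tau>) * (cmod z)\<^sup>2))"
      by (intro mult_left_mono) auto
    then show ?thesis using False by (simp add: trunc_def g_def mult_ac)
  qed
  have "(\<integral>z. cmod z ^ (2 * j) * gauss z - exp (- \<tau> * R\<^sup>2) * g z \<partial>lborel) \<le> trunc.mom R j"
    unfolding trunc.mom_def
    using pt trunc.moments integrable_gaussian_moment ig by (intro integral_mono) auto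
  also have "(\<integral>z. cmod z ^ (2 * j) * gauss z - exp (- \<tau> * R\<^sup>2) * g z \<partial>lborel)
     = pi * fact j - exp (- \<tau> * R\<^sup>2) * (\<integral>z. g z \<partial>lborel)"
    using integrable_gaussian_moment ig gaussian_mom[of j] by (simp add: gaussian.mom_def)
  finally have "pi * fact j - exp (- \<tau> * R\<^sup>2) * (\<integral>z. g z \<partial>lborel) \<le> trunc.mom R j" .
  moreover have "exp (- \<tau> * R\<^sup>2) * (\<integral>z. g z \<partial>lborel) \<le> exp (- \<tau> * R\<^sup>2) * (pi * fact j / (1 - \<tau>) ^ n)"
    using ig_le by (intro mult_left_mono) auto
  ultimately show ?thesis by (simp add: algebra_simps)
qed

text \<open>Truncation to a disc keeps the weight radial, so the probability that all points lie in
  the disc is exactly the product of the ratios of truncated to full moments. Each ratio is at least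
  1 - \<epsilon>, and Bernoulli's inequality finishes.\<close>

lemma ginibre_radius:
  assumes \<tau>: "0 \<le> \<tau>" "\<tau> < 1" and R: "0 \<le> R"
  shows "measure (ginibre n) {x \<in> space (lborel_on {1..n}). \<not> (\<forall>k\<in>{1..n}. cmod (x k) \<le> R)}
    \<le> real n * (exp (- \<tau> * R\<^sup>2) / (1 - \<tau>) ^ n)"
proof -
  define \<epsilon> where "\<epsilon> = exp (- \<tau> * R\<^sup>2) / (1 - \<tau>) ^ n"
  define B where "B = {x \<in> space (lborel_on {1..n}). \<forall>k\<in>{1..n}. cmod (x k) \<le> R}"
  have [measurable]: "B \<in> sets (lborel_on {1..n})" unfolding B_def by measurable
  have "emeasure (ginibre n) B
     = (\<integral>\<^sup>+x. ennreal (vdm {1..n} x * trunc.wprod R {1..n} x) \<partial>lborel_on {1..n}) / ennreal (ginibre_Z n)"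
    unfolding emeasure_ginibre[OF \<open>B \<in> _\<close>]
  proof (intro arg_cong2[where f = "(/)"] nn_integral_cong refl)
    fix x assume x: "x \<in> space (lborel_on {1..n})"
    show "ennreal (ginibre_weight n x) * indicator B x = ennreal (vdm {1..n} x * trunc.wprod R {1..n} x)"
    proof (cases "x \<in> B")
      case True
      then have "gaussian.wprod {1..n} x = trunc.wprod R {1..n} x"
        unfolding gaussian.wprod_def trunc.wprod_def B_def by (intro prod.cong) (auto simp: trunc_def)
      then show ?thesis using True by (simp add: ginibre_weight_eq)
    next
      case False
      then obtain k where "k \<in> {1..n}" "\<not> cmod (x k) \<le> R" using x by (auto simp: B_def)
      then have "trunc.wprod R {1..n} x = 0"
        unfolding trunc.wprod_def by (intro prod_zero) (auto simp: trunc_def)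
      then show ?thesis using False by simp
    qed
  qed
  also have "\<dots> = ennreal (trunc.Zint R {1..n} / ginibre_Z n)"
    using trunc.Zint_eq[of "{1..n}" R] trunc.mom_nonneg[of R] ginibre_Z_pos[of n]
    by (subst trunc.nn_integral_vdm_wprod) (auto intro!: divide_ennreal mult_nonneg_nonneg prod_nonneg)
  finally have mB: "measure (ginibre n) B = trunc.Zint R {1..n} / ginibre_Z n"
    using trunc.Zint_eq[of "{1..n}" R] trunc.mom_nonneg[of R] ginibre_Z_pos[of n]
    by (simp add: measure_def prod_nonneg)
  \<comment> \<open>The product estimate needs 1 - \<epsilon> \<ge> 0; for \<epsilon> > 1 the left
    side is negative, except at n = 0, where both sides are 1.\<close>
  have "1 - real n * \<epsilon> \<le> measure (ginibre n) B"
  proof (cases "\<epsilon> \<le> 1")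
    case True
    have "(1 - \<epsilon>) ^ n * ginibre_Z n = fact n * (\<Prod>j<n. (1 - \<epsilon>) * (pi * fact j))"
      by (simp add: ginibre_Z_def prod.distrib)
    also have "\<dots> \<le> fact n * (\<Prod>j<n. trunc.mom R j)"
      using True trunc_mom_ge[OF \<tau> _ R, of _ n, folded \<epsilon>_def]
      by (intro mult_left_mono prod_mono conjI mult_nonneg_nonneg) simp_all
    finally have "(1 - \<epsilon>) ^ n \<le> trunc.Zint R {1..n} / ginibre_Z n"
      using trunc.Zint_eq[of "{1..n}" R] ginibre_Z_pos[of n] by (simp add: field_simps)
    moreover have "1 - real n * \<epsilon> \<le> (1 - \<epsilon>) ^ n"
      using Bernoulli_inequality[of "- \<epsilon>" n] True by simp
    ultimately show ?thesis using mB by linarith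
  next
    case False
    show ?thesis
    proof (cases "n = 0")
      case True
      then have "measure (ginibre n) B = 1"
        using ginibre.prob_space[of n] by (simp add: B_def space_ginibre)
      then show ?thesis using True by simp
    next
      case n: False
      with False have "real n * \<epsilon> \<ge> 1 * 1" by (intro mult_mono) auto
      then show ?thesis using measure_nonneg[of "ginibre n" B] by linarith
    qed
  qed
  moreover have "{x \<in> space (lborel_on {1..n}). \<not> (\<forall>k\<in>{1..n}. cmod (x k) \<le> R)} = space (ginibre n) - B"
    by (auto simp: B_def space_ginibre)
  ultimately show ?thesis
    unfolding \<epsilon>_def[symmetric] using ginibre.prob_compl[of B n] by (simp add: sets_ginibre)
qed

section \<open>Power sums and the inner disc\<close>

lemma exp_le_quadratic:
  fixes x :: real
  assumes "\<bar>x\<bar> \<le> 1"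
  shows "exp x \<le> 1 + x + x\<^sup>2"
proof (cases "x \<ge> 0")
  case True
  then show ?thesis using assms by (intro exp_bound) auto
next
  case False
  have "exp x = 1 / exp (- x)" by (simp add: exp_minus field_simps)
  also have "\<dots> \<le> 1 / (1 - x)"
    using exp_ge_add_one_self[of "- x"] False by (intro divide_left_mono) auto
  also have "\<dots> \<le> 1 + x + x\<^sup>2"
  proof -
    have "(1 + x + x\<^sup>2) * (1 - x) = 1 + (- x) ^ 3"
      by (simp add: algebra_simps power2_eq_square power3_eq_cube)
    also have "\<dots> \<ge> 1" using False by simp
    finally show ?thesis using False by (simp add: pos_divide_le_eq)
  qed
  finally show ?thesis .
qed

text \<open>The moments of the tilted weight exceed the Gaussian ones only to second order in \<open>t\<close>,
  because the linear term is killed by rotation invariance.\<close>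

lemma ginibre_power_sum:
  fixes \<delta> :: real
  assumes n: "n \<ge> 1" and \<rho>: "0 < \<rho>" and m: "m \<ge> 1" and \<omega>: "cmod \<omega> = 1"
    and t: "0 \<le> t" "t * \<rho> ^ m \<le> 1"
  shows "measure (ginibre n) {x \<in> space (lborel_on {1..n}).
      (\<forall>k\<in>{1..n}. cmod (x k) \<le> \<rho> * sqrt (real n)) \<and>
      real n * \<delta> \<le> Re (\<omega> * (\<Sum>k=1..n. (x k / of_real (sqrt (real n))) ^ m))}
    \<le> exp (real n * (t\<^sup>2 * \<rho> ^ (2 * m) - t * \<delta>))" (is "measure _ ?A \<le> _")
proof -
  define R where "R = \<rho> * sqrt (real n)"
  define h where "h z = Re (\<omega> * (z / of_real (sqrt (real n))) ^ m)" for z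
  define w where "w z = trunc R z * exp (t * h z)" for z
  \<comment> \<open>A uniform bound for the square of the exponent \<open>t * h z\<close> on the
    disc of radius \<open>R\<close>; each moment grows by at most the factor 1 + \<kappa>.\<close>
  define \<kappa> where "\<kappa> = t\<^sup>2 * \<rho> ^ (2 * m)"
  have [measurable]: "h \<in> borel_measurable borel" unfolding h_def by measurable
  have [measurable]: "w \<in> borel_measurable borel" unfolding w_def by measurable
  have h_le: "\<bar>h z\<bar> \<le> \<rho> ^ m" if "cmod z \<le> R" for z
  proof -
    have "\<bar>h z\<bar> \<le> cmod (\<omega> * (z / of_real (sqrt (real n))) ^ m)"
      unfolding h_def by (rule abs_Re_le_cmod)
    also have "\<dots> = (cmod z / sqrt (real n)) ^ m"
      using \<omega> by (simp add: norm_mult norm_power norm_divide)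
    also have "\<dots> \<le> \<rho> ^ m"
      using that n by (intro power_mono) (auto simp: R_def divide_simps)
    finally show ?thesis .
  qed
  have th: "\<bar>t * h z\<bar> \<le> 1" "(t * h z)\<^sup>2 \<le> \<kappa>" if "cmod z \<le> R" for z
  proof -
    have "\<bar>t * h z\<bar> \<le> t * \<rho> ^ m"
      using h_le[OF that] t by (simp add: abs_mult mult_left_mono)
    with t show "\<bar>t * h z\<bar> \<le> 1" by simp
    have "(t * h z)\<^sup>2 \<le> (t * \<rho> ^ m)\<^sup>2"
      using \<open>\<bar>t * h z\<bar> \<le> t * \<rho> ^ m\<close> by (simp add: abs_le_square_iff[symmetric])
    then show "(t * h z)\<^sup>2 \<le> \<kappa>" by (simp add: \<kappa>_def power_mult_distrib power_mult mult.commute)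
  qed
  interpret w: moment_weight w
  proof (rule moment_weight_dominated[where C = "exp 1"])
    show "0 \<le> w z" for z using trunc.w_nonneg by (simp add: w_def)
    show "w z \<le> exp 1 * gauss z" for z
      using th(1)[of z] gauss_pos[of z] by (auto simp: w_def trunc_def mult.commute intro!: mult_left_mono)
  qed measurable
  have h_int: "integrable lborel (\<lambda>z. cmod z ^ (2 * j) * trunc R z * h z)"
    and h_zero: "(\<integral>z. cmod z ^ (2 * j) * trunc R z * h z \<partial>lborel) = 0" for j
  proof -
    define c where "c = \<omega> / of_real (sqrt (real n)) ^ m"
    let ?g = "\<lambda>z. z ^ (j + m) * cnj (z ^ j) * of_real (trunc R z)"
    have eq: "cmod z ^ (2 * j) * trunc R z * h z = Re (c * ?g z)" for z
    proof -
      have "c * ?g z = (\<omega> * (z / of_real (sqrt (real n))) ^ m) * (z ^ j * cnj z ^ j) * of_real (trunc R z)"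
        by (simp add: c_def power_add power_divide mult_ac)
      also have "\<dots> = of_real (cmod z ^ (2 * j) * trunc R z) * (\<omega> * (z / of_real (sqrt (real n))) ^ m)"
        unfolding power_times_cnj_power by simp
      finally have e: "c * ?g z
        = of_real (cmod z ^ (2 * j) * trunc R z) * (\<omega> * (z / of_real (sqrt (real n))) ^ m)" .
      show ?thesis unfolding e by (simp add: h_def del: of_real_mult of_real_power)
    qed
    have ig: "integrable lborel (\<lambda>z. c * ?g z)"
      by (intro integrable_mult_right trunc.integrable_power_cnj_power)
    then show "integrable lborel (\<lambda>z. cmod z ^ (2 * j) * trunc R z * h z)"
      unfolding eq by (rule integrable_Re)
    have "(\<integral>z. Re (c * ?g z) \<partial>lborel) = Re (\<integral>z. c * ?g z \<partial>lborel)"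
      by (rule integral_Re[OF ig])
    \<comment> \<open>The factor z^m unbalances |z|^(2 j) to the exponents j + m and j, which differ
      because m \<ge> 1, so orthogonality of monomials applies.\<close>
    also have "(\<integral>z. c * ?g z \<partial>lborel) = 0"
      using m trunc.integral_power_cnj_power[of "j + m" j R] by (simp del: complex_cnj_power)
    finally show "(\<integral>z. cmod z ^ (2 * j) * trunc R z * h z \<partial>lborel) = 0"
      unfolding eq by simp
  qed
  have mom_le: "w.mom j \<le> (1 + \<kappa>) * (pi * fact j)" for j
  proof -
    have tm: "trunc.mom R j \<le> pi * fact j"
      unfolding trunc.mom_def gaussian_mom[symmetric] gaussian.mom_def
      using trunc.moments gaussian.moments gauss_pos
      by (intro integral_mono mult_left_mono) (auto simp: trunc_def less_imp_le)
    have "w.mom j \<le> (\<integral>z. (1 + \<kappa>) * (cmod z ^ (2 * j) * trunc R z)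
        + t * (cmod z ^ (2 * j) * trunc R z * h z) \<partial>lborel)"
      unfolding w.mom_def
    proof (intro integral_mono w.moments Bochner_Integration.integrable_add integrable_mult_right
        trunc.moments h_int)
      fix z
      show "cmod z ^ (2 * j) * w z \<le> (1 + \<kappa>) * (cmod z ^ (2 * j) * trunc R z)
        + t * (cmod z ^ (2 * j) * trunc R z * h z)"
      proof (cases "cmod z \<le> R")
        case True
        have "exp (t * h z) \<le> 1 + \<kappa> + t * h z"
          using exp_le_quadratic[OF th(1)[OF True]] th(2)[OF True] by linarith
        then have "(cmod z ^ (2 * j) * trunc R z) * exp (t * h z)
            \<le> (cmod z ^ (2 * j) * trunc R z) * (1 + \<kappa> + t * h z)"
          using trunc.w_nonneg[of R z] by (intro mult_left_mono) auto
        then show ?thesis by (simp add: w_def algebra_simps)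
      qed (simp add: w_def trunc_def)
    qed
    also have "\<dots> = (1 + \<kappa>) * trunc.mom R j"
      using trunc.moments h_int h_zero by (simp add: trunc.mom_def)
    also have "\<dots> \<le> (1 + \<kappa>) * (pi * fact j)"
      using tm \<rho> by (intro mult_left_mono) (auto simp: \<kappa>_def)
    finally show ?thesis .
  qed
  \<comment> \<open>The tilted weight is not radial: only the inequality is available, and it points
    the right way.\<close>
  have "w.Zint {1..n} \<le> fact n * (\<Prod>j<n. w.mom j)"
    using w.Zint_le[of "{1..n}"] by simp
  also have "\<dots> \<le> fact n * (\<Prod>j<n. (1 + \<kappa>) * (pi * fact j))"
    by (intro mult_left_mono prod_mono conjI w.mom_nonneg mom_le) auto
  also have "\<dots> = (1 + \<kappa>) ^ n * ginibre_Z n"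
    by (simp add: ginibre_Z_def prod.distrib)
  finally have Z: "w.Zint {1..n} \<le> (1 + \<kappa>) ^ n * ginibre_Z n" .
  let ?c = "exp (- (t * (real n * \<delta>)))"
  have "measure (ginibre n) ?A \<le> ?c * (1 + \<kappa>) ^ n"
  proof (rule measure_ginibre_le[where f = "\<lambda>x. ennreal ?c * ennreal (vdm {1..n} x * w.wprod {1..n} x)"])
    show "?A \<in> sets (lborel_on {1..n})" by measurable
    show "0 \<le> ?c * (1 + \<kappa>) ^ n" using \<rho> by (simp add: \<kappa>_def)
    have "(\<integral>\<^sup>+x. ennreal ?c * ennreal (vdm {1..n} x * w.wprod {1..n} x) \<partial>lborel_on {1..n})
       = ennreal ?c * ennreal (w.Zint {1..n})"
      by (simp add: nn_integral_cmult w.nn_integral_vdm_wprod)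
    also have "\<dots> = ennreal (?c * w.Zint {1..n})"
      by (simp add: ennreal_mult')
    also have "\<dots> \<le> ennreal (?c * (1 + \<kappa>) ^ n * ginibre_Z n)"
      using Z by (intro ennreal_leI) (simp add: mult.assoc)
    finally show "(\<integral>\<^sup>+x. ennreal ?c * ennreal (vdm {1..n} x * w.wprod {1..n} x) \<partial>lborel_on {1..n})
       \<le> ennreal (?c * (1 + \<kappa>) ^ n * ginibre_Z n)" .
    fix x assume x: "x \<in> ?A"
    have "w.wprod {1..n} x = gaussian.wprod {1..n} x * exp (t * (\<Sum>k=1..n. h (x k)))"
      using x unfolding w.wprod_def gaussian.wprod_def sum_distrib_left exp_sum[OF finite_atLeastAtMost]
      by (subst prod.distrib[symmetric], intro prod.cong) (auto simp: w_def trunc_def R_def)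
    moreover have "(\<Sum>k=1..n. h (x k)) \<ge> real n * \<delta>"
      using x by (simp add: h_def sum_distrib_left)
    then have "1 \<le> ?c * exp (t * (\<Sum>k=1..n. h (x k)))"
      using t by (simp add: exp_add[symmetric] mult_left_mono)
    ultimately have "ginibre_weight n x * 1 \<le> ginibre_weight n x * (?c * exp (t * (\<Sum>k=1..n. h (x k))))"
      by (intro mult_left_mono ginibre_weight_nonneg)
    also have "\<dots> = ?c * (vdm {1..n} x * w.wprod {1..n} x)"
      using \<open>w.wprod {1..n} x = _\<close> by (simp add: ginibre_weight_eq mult_ac)
    finally have "ginibre_weight n x \<le> ?c * (vdm {1..n} x * w.wprod {1..n} x)" by simp
    then show "ennreal (ginibre_weight n x) \<le> ennreal ?c * ennreal (vdm {1..n} x * w.wprod {1..n} x)"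
      by (simp add: ennreal_mult'[symmetric] ennreal_leI)
  qed
  also have "(1 + \<kappa>) ^ n \<le> exp \<kappa> ^ n"
    using \<rho> by (intro power_mono exp_ge_add_one_self) (auto simp: \<kappa>_def)
  also have "?c * exp \<kappa> ^ n = exp (real n * (\<kappa> - t * \<delta>))"
    by (simp add: exp_of_nat_mult[symmetric] exp_add[symmetric] algebra_simps)
  finally show ?thesis by (simp add: \<kappa>_def)
qed

section \<open>Gaussian norms of polynomials and the inner disc\<close>

lemma (in radial_weight) integral_poly_sq:
  fixes p :: "complex poly"
  shows "integrable lborel (\<lambda>z. (cmod (poly p z))\<^sup>2 * w z)"
    and "(\<integral>z. (cmod (poly p z))\<^sup>2 * w z \<partial>lborel) = (\<Sum>i\<le>degree p. (cmod (coeff p i))\<^sup>2 * mom i)"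
proof -
  let ?g = "\<lambda>i j z. coeff p i * cnj (coeff p j) * (z ^ i * cnj (z ^ j) * of_real (w z))"
  have eq: "of_real ((cmod (poly p z))\<^sup>2 * w z) = (\<Sum>i\<le>degree p. \<Sum>j\<le>degree p. ?g i j z)" for z
    unfolding of_real_mult complex_norm_square poly_altdef
    by (simp add: sum_distrib_left sum_distrib_right mult_ac) (rule sum.swap)
  have int: "integrable lborel (\<lambda>z. ?g i j z)" for i j
    by (intro integrable_mult_right integrable_power_cnj_power)
  have ic: "integrable lborel (\<lambda>z. complex_of_real ((cmod (poly p z))\<^sup>2 * w z))"
    unfolding eq by (intro Bochner_Integration.integrable_sum int)
  from integrable_Re[OF ic] show "integrable lborel (\<lambda>z. (cmod (poly p z))\<^sup>2 * w z)"
    by (simp only: Re_complex_of_real)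
  have "(\<integral>z. complex_of_real ((cmod (poly p z))\<^sup>2 * w z) \<partial>lborel)
     = (\<Sum>i\<le>degree p. \<Sum>j\<le>degree p. \<integral>z. ?g i j z \<partial>lborel)"
    unfolding eq
    by (subst Bochner_Integration.integral_sum, intro Bochner_Integration.integrable_sum int)
      (intro sum.cong refl Bochner_Integration.integral_sum int)
  \<comment> \<open>Parseval: orthogonality of the monomials leaves the diagonal i = j.\<close>
  also have "\<dots> = (\<Sum>i\<le>degree p. coeff p i * cnj (coeff p i) * of_real (mom i))"
    by (simp add: integral_power_cnj_power if_distrib[of "\<lambda>t. _ * t"] del: complex_cnj_power cong: if_cong)
  also have "\<dots> = of_real (\<Sum>i\<le>degree p. (cmod (coeff p i))\<^sup>2 * mom i)"
    by (simp only: complex_norm_square[symmetric] of_real_sum of_real_mult)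
  finally show "(\<integral>z. (cmod (poly p z))\<^sup>2 * w z \<partial>lborel) = (\<Sum>i\<le>degree p. (cmod (coeff p i))\<^sup>2 * mom i)"
    by (simp only: integral_complex_of_real of_real_eq_iff)
qed

text \<open>\<open>exp ((cmod z)\<^sup>2) / pi\<close> is the diagonal of the reproducing kernel of Bargmann--Fock space.\<close>

lemma cmod_poly_sq_le:
  fixes p :: "complex poly"
  shows "(cmod (poly p z))\<^sup>2 \<le> (\<integral>y. (cmod (poly p y))\<^sup>2 * gauss y \<partial>lborel) * (exp ((cmod z)\<^sup>2) / pi)"
proof -
  \<comment> \<open>The monomial z^i has squared Gaussian norm pi i!. Splitting off its root makes
    Cauchy-Schwarz return the squared norm of \<open>p\<close> from \<open>?a\<close> and a partial
    sum of exp (|z|^2) / pi from \<open>?b\<close>.\<close>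
  let ?a = "\<lambda>i. cmod (coeff p i) * sqrt (pi * fact i)"
  let ?b = "\<lambda>i. cmod z ^ i / sqrt (pi * fact i)"
  have "cmod (poly p z) \<le> (\<Sum>i\<le>degree p. cmod (coeff p i * z ^ i))"
    unfolding poly_altdef by (rule norm_sum)
  also have "\<dots> = (\<Sum>i\<le>degree p. ?a i * ?b i)"
    by (intro sum.cong refl) (simp add: norm_mult norm_power)
  finally have "(cmod (poly p z))\<^sup>2 \<le> (\<Sum>i\<le>degree p. ?a i * ?b i)\<^sup>2"
    by (intro power_mono) auto
  also have "\<dots> \<le> (\<Sum>i\<le>degree p. (?a i)\<^sup>2) * (\<Sum>i\<le>degree p. (?b i)\<^sup>2)"
    by (rule Cauchy_Schwarz_ineq_sum)
  also have "(\<Sum>i\<le>degree p. (?a i)\<^sup>2) = (\<integral>y. (cmod (poly p y))\<^sup>2 * gauss y \<partial>lborel)"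
    unfolding gaussian.integral_poly_sq gaussian_mom
    by (intro sum.cong refl) (simp add: power_mult_distrib)
  also have "(\<Sum>i\<le>degree p. (?b i)\<^sup>2) = (\<Sum>i\<le>degree p. ((cmod z)\<^sup>2) ^ i /\<^sub>R fact i) / pi"
    unfolding sum_divide_distrib
    by (intro sum.cong refl) (simp add: power_divide power_mult[symmetric] mult.commute divide_simps)
  also have "(\<Sum>i\<le>degree p. ((cmod z)\<^sup>2) ^ i /\<^sub>R fact i) \<le> exp ((cmod z)\<^sup>2)"
    unfolding exp_def by (intro sum_le_suminf summable_exp_generic) auto
  finally show ?thesis
    by (simp add: mult_left_mono divide_right_mono integral_nonneg gauss_def)
qed

lemma ginibre_Z_Suc: "ginibre_Z (Suc n) = real (Suc n) * (pi * fact n) * ginibre_Z n"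
  by (simp add: ginibre_Z_def algebra_simps)

text \<open>The Ginibre weight in \<open>n + 1\<close> variables is the one in \<open>n\<close> variables times the squared modulus
  of the characteristic polynomial at the new variable.\<close>

lemma nn_integral_ginibre_node_poly:
  "(\<integral>\<^sup>+x. ennreal (ginibre_weight n x)
       * (\<integral>\<^sup>+y. ennreal ((cmod (node_poly {1..n} x y))\<^sup>2 * gauss y) \<partial>lborel) \<partial>lborel_on {1..n})
   = ennreal (ginibre_Z (Suc n))"
proof -
  \<comment> \<open>The free index 0 carries the new variable; \<open>gaussian_Zint\<close> sees
    only the cardinality n + 1, so \<open>{0..n}\<close> is as good as
    \<open>{1..Suc n}\<close>.\<close>
  let ?J = "{1..n}" and ?I = "insert 0 {1..n}"
  have J: "finite ?J" "0 \<notin> ?J" by auto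
  have "ennreal (ginibre_Z (Suc n)) = ennreal (gaussian.Zint ?I)"
    by (simp add: gaussian_Zint)
  also have "\<dots> = (\<integral>\<^sup>+x. ennreal (vdm ?I x * gaussian.wprod ?I x) \<partial>lborel_on ?I)"
    by (simp add: gaussian.nn_integral_vdm_wprod)
  also have "\<dots> = (\<integral>\<^sup>+x. (\<integral>\<^sup>+y. ennreal (vdm ?I (x(0 := y)) * gaussian.wprod ?I (x(0 := y))) \<partial>lborel)
       \<partial>lborel_on ?J)"
    by (rule lborel_product.product_nn_integral_insert[OF J]) measurable
  also have "\<dots> = (\<integral>\<^sup>+x. (\<integral>\<^sup>+y. ennreal (ginibre_weight n x)
       * ennreal ((cmod (node_poly ?J x y))\<^sup>2 * gauss y) \<partial>lborel) \<partial>lborel_on ?J)"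
  proof (intro nn_integral_cong)
    fix x y
    have "vdm ?J (x(0 := y)) = vdm ?J x" "node_poly ?J (x(0 := y)) y = node_poly ?J x y"
      by (intro vdm_cong node_poly_cong; simp)+
    then show "ennreal (vdm ?I (x(0 := y)) * gaussian.wprod ?I (x(0 := y)))
       = ennreal (ginibre_weight n x) * ennreal ((cmod (node_poly ?J x y))\<^sup>2 * gauss y)"
      unfolding vdm_insert[OF J] gaussian.wprod_insert[OF J] ginibre_weight_eq
      using vdm_nonneg[of ?J x] gaussian.wprod_nonneg[of ?J x] gauss_pos[of y]
      by (simp add: ennreal_mult'[symmetric] mult_ac)
  qed
  also have "\<dots> = (\<integral>\<^sup>+x. ennreal (ginibre_weight n x)
       * (\<integral>\<^sup>+y. ennreal ((cmod (node_poly {1..n} x y))\<^sup>2 * gauss y) \<partial>lborel) \<partial>lborel_on {1..n})"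
    by (intro nn_integral_cong nn_integral_cmult) measurable
  finally show ?thesis ..
qed

lemma root_poly_scaled:
  assumes "n \<ge> 1"
  shows "root_poly n (\<lambda>k. x k / of_real (sqrt (real n))) z
    = node_poly {1..n} x (of_real (sqrt (real n)) * z) / of_real (sqrt (real n)) ^ n"
proof -
  have "z - x k / of_real (sqrt (real n)) = (of_real (sqrt (real n)) * z - x k) / of_real (sqrt (real n))" for k
    using assms by (simp add: field_simps)
  then show ?thesis
    by (simp add: root_poly_def node_poly_def prod_dividef)
qed

text \<open>If |p_n| reaches 1 anywhere in the disc, \<open>cmod_poly_sq_le\<close> makes the
  Gaussian norm of the unscaled polynomial large, which Markov's inequality makes unlikely.
  \<open>real (Suc n) * fact n\<close> is, up to the factor pi, the ratio of consecutive normalising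
  constants.\<close>

lemma ginibre_inner_disc:
  assumes n: "n \<ge> 1" and r: "0 \<le> r"
    and A: "{x \<in> space (lborel_on {1..n}).
        \<not> ball 0 r \<subseteq> lemniscate n (\<lambda>k. x k / of_real (sqrt (real n)))} \<in> sets (lborel_on {1..n})"
      (is "?A \<in> _")
  shows "measure (ginibre n) ?A \<le> real (Suc n) * fact n * exp (real n * r\<^sup>2) / real n ^ n"
proof (rule measure_ginibre_le[OF A])
  let ?Q = "\<lambda>x. \<integral>\<^sup>+y. ennreal ((cmod (node_poly {1..n} x y))\<^sup>2 * gauss y) \<partial>lborel"
  \<comment> \<open>On the bad event \<open>1 / c\<close> bounds the squared Gaussian norm from
    below: after rescaling, the polynomial has modulus at least n^(n/2) at a point of modulus below
    r sqrt n.\<close>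
  define c where "c = exp (real n * r\<^sup>2) / (pi * real n ^ n)"
  have c: "c \<ge> 0" by (simp add: c_def)
  show "0 \<le> real (Suc n) * fact n * exp (real n * r\<^sup>2) / real n ^ n" by simp
  have "(\<integral>\<^sup>+x. ennreal c * (ennreal (ginibre_weight n x) * ?Q x) \<partial>lborel_on {1..n})
      = ennreal c * ennreal (ginibre_Z (Suc n))"
  proof (subst nn_integral_cmult)
    have "(\<lambda>p. node_poly {1..n} (fst p) (snd p))
        \<in> borel_measurable (lborel_on {1..n} \<Otimes>\<^sub>M (lborel :: complex measure))"
      unfolding node_poly_def by measurable
    then have [measurable]: "(\<lambda>(x, y). ennreal ((cmod (node_poly {1..n} x y))\<^sup>2 * gauss y))
        \<in> borel_measurable (lborel_on {1..n} \<Otimes>\<^sub>M (lborel :: complex measure))"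
      unfolding split_beta' by measurable
    show "(\<lambda>x. ennreal (ginibre_weight n x) * ?Q x) \<in> borel_measurable (lborel_on {1..n})"
      by measurable
  qed (simp only: nn_integral_ginibre_node_poly)
  also have "\<dots> = ennreal (c * ginibre_Z (Suc n))"
    using c by (simp add: ennreal_mult')
  also have "c * ginibre_Z (Suc n) = real (Suc n) * fact n * exp (real n * r\<^sup>2) / real n ^ n * ginibre_Z n"
  proof -
    have "e / (pi * N) * (S * (pi * f) * Z) = S * f * e / N * Z" for e N S f Z :: real
      by simp
    then show ?thesis unfolding c_def ginibre_Z_Suc .
  qed
  finally show "(\<integral>\<^sup>+x. ennreal c * (ennreal (ginibre_weight n x) * ?Q x) \<partial>lborel_on {1..n})
      \<le> ennreal (real (Suc n) * fact n * exp (real n * r\<^sup>2) / real n ^ n * ginibre_Z n)" by simp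
  fix x assume "x \<in> ?A"
  then obtain z where z: "cmod z < r"
    and ge: "1 \<le> cmod (root_poly n (\<lambda>k. x k / of_real (sqrt (real n))) z)"
    by (auto simp: lemniscate_def subset_iff not_less)
  define P where "P = (\<Prod>j\<in>{1..n}. [:- x j, 1:])"
  define q where "q = (\<integral>y. (cmod (poly P y))\<^sup>2 * gauss y \<partial>lborel)"
  define y where "y = of_real (sqrt (real n)) * z"
  have "sqrt (real n) ^ n \<le> cmod (poly P y)"
    using ge n by (simp add: root_poly_scaled node_poly_eq_poly P_def y_def norm_divide norm_power divide_simps)
  then have "(sqrt (real n) ^ n)\<^sup>2 \<le> (cmod (poly P y))\<^sup>2"
    by (intro power_mono) auto
  also have "(sqrt (real n) ^ n)\<^sup>2 = real n ^ n"
    by (simp add: power_mult[symmetric] mult.commute[of n]) (simp add: power_mult)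
  also have "(cmod (poly P y))\<^sup>2 \<le> q * (exp ((cmod y)\<^sup>2) / pi)"
    unfolding q_def by (rule cmod_poly_sq_le)
  also have "\<dots> \<le> q * (exp (real n * r\<^sup>2) / pi)"
  proof (intro mult_left_mono divide_right_mono)
    have "(cmod y)\<^sup>2 = real n * (cmod z)\<^sup>2" by (simp add: y_def norm_mult power_mult_distrib)
    also have "\<dots> \<le> real n * r\<^sup>2" using z by (intro mult_left_mono power_mono) auto
    finally show "exp ((cmod y)\<^sup>2) \<le> exp (real n * r\<^sup>2)" by simp
    show "0 \<le> q" unfolding q_def using gauss_pos by (intro Bochner_Integration.integral_nonneg) (auto simp: less_imp_le)
  qed auto
  finally have "1 \<le> c * q"
    using n by (simp add: c_def field_simps)
  moreover have "?Q x = ennreal q"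
    unfolding q_def node_poly_eq_poly P_def[symmetric] using gauss_pos
    by (intro nn_integral_eq_integral gaussian.integral_poly_sq AE_I2) (auto simp: less_imp_le)
  ultimately have "1 \<le> ennreal c * ?Q x"
    using c by (simp add: ennreal_mult'[symmetric])
  from mult_left_mono[OF this, of "ennreal (ginibre_weight n x)"]
  show "ennreal (ginibre_weight n x) \<le> ennreal c * (ennreal (ginibre_weight n x) * ?Q x)"
    by (simp add: mult_ac)
qed

section \<open>Deterministic lower bound and measurability\<close>

text \<open>The real part of the Taylor series of \<open>ln (1 - u)\<close>, cut after
  \<open>N\<close> terms; with the denominators dropped, the tail is dominated by a geometric series
  in \<open>q\<close>.\<close>

lemma ln_cmod_one_minus_ge:
  assumes q: "cmod u \<le> q" "q < 1"
  shows "ln (cmod (1 - u)) \<ge> - (\<Sum>m=1..N. Re (u ^ m) / real m) - q ^ Suc N / (1 - q)"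
proof -
  have u: "cmod u < 1" and q0: "0 \<le> q" using q norm_ge_zero[of u] by linarith+
  let ?f = "\<lambda>m. - (u ^ m) / of_nat m"
  have s: "?f sums ln (1 - u)"
    using Ln_series'[of "- u"] u by simp
  have tail: "(\<lambda>m. ?f (m + Suc N)) sums (ln (1 - u) - (\<Sum>m<Suc N. ?f m))"
    using s by (rule sums_split_initial_segment)
  have g: "(\<lambda>m. q ^ Suc N * q ^ m) sums (q ^ Suc N * (1 / (1 - q)))"
    using q q0 by (intro sums_mult geometric_sums) auto
  have "norm (?f (m + Suc N)) \<le> q ^ Suc N * q ^ m" for m
  proof -
    have "norm (?f (m + Suc N)) = cmod u ^ (m + Suc N) / real (m + Suc N)"
      by (simp add: norm_divide norm_power norm_mult del: of_nat_Suc of_nat_add)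
    also have "\<dots> \<le> cmod u ^ (m + Suc N) / 1"
      by (intro divide_left_mono) auto
    also have "\<dots> \<le> q ^ (m + Suc N)"
      using q by (simp add: power_mono del: power_Suc)
    finally show ?thesis by (simp only: power_add mult.commute)
  qed
  from norm_sums_le[OF tail g this]
  have "norm (ln (1 - u) - (\<Sum>m<Suc N. ?f m)) \<le> q ^ Suc N / (1 - q)" by simp
  then have "\<bar>Re (ln (1 - u) - (\<Sum>m<Suc N. ?f m))\<bar> \<le> q ^ Suc N / (1 - q)"
    using abs_Re_le_cmod order.trans by blast
  moreover have "Re (\<Sum>m<Suc N. ?f m) = - (\<Sum>m=1..N. Re (u ^ m) / real m)"
  proof -
    have "{..<Suc N} = insert 0 {1..N}" by auto
    then show ?thesis by (simp add: sum_negf)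
  qed
  moreover have "Re (ln (1 - u)) = ln (cmod (1 - u))"
    using u by (intro Re_Ln) auto
  ultimately show ?thesis by simp
qed

text \<open>The truncated logarithm is summed over the roots. As |z| > 1, dividing by
  \<open>z ^ m\<close> only shrinks the power sums, and \<open>ln_s\<close> says that power sums and
  tails together cost at most ln s \<le> ln |z| per root. The four directions \<omega> bound real
  and imaginary parts from both sides, whence the factor 2.\<close>

lemma root_poly_ge_1:
  assumes X: "\<And>k. k \<in> {1..n} \<Longrightarrow> cmod (X k) \<le> \<rho>" and \<rho>: "0 < \<rho>" "\<rho> < s" and s: "1 < s"
    and S: "\<And>m \<omega>. m \<in> {1..N} \<Longrightarrow> \<omega> \<in> {1, - 1, \<i>, - \<i>} \<Longrightarrow>
      Re (\<omega> * (\<Sum>k=1..n. X k ^ m)) \<le> real n * \<delta>"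
    and ln_s: "2 * \<delta> * real N + (\<rho> / s) ^ Suc N / (1 - \<rho> / s) \<le> ln s"
    and z: "s \<le> cmod z"
  shows "1 \<le> cmod (root_poly n X z)"
proof -
  have z0: "z \<noteq> 0" "1 < cmod z" using z s by auto
  define q where "q = \<rho> / s"
  have q: "q < 1" using \<rho> s by (simp add: q_def)
  define T where "T = q ^ Suc N / (1 - q)"
  have u_le: "cmod (X k / z) \<le> q" if "k \<in> {1..n}" for k
    using X[OF that] z s \<rho> unfolding q_def norm_divide by (intro frac_le) auto
  have nz: "cmod (1 - X k / z) > 0" if "k \<in> {1..n}" for k
    using u_le[OF that] q by auto
  have factor: "cmod (z - X k) = cmod z * cmod (1 - X k / z)" for k
  proof -
    have "z - X k = z * (1 - X k / z)" using z0 by (simp add: field_simps)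
    then show ?thesis by (metis norm_mult)
  qed
  have Sm: "(\<Sum>k=1..n. Re ((X k / z) ^ m)) \<le> 2 * (real n * \<delta>)" if m: "m \<in> {1..N}" for m
  proof -
    let ?S = "\<Sum>k=1..n. X k ^ m"
    have "\<bar>Re ?S\<bar> \<le> real n * \<delta>" "\<bar>Im ?S\<bar> \<le> real n * \<delta>"
      using S[OF m, of 1] S[OF m, of "- 1"] S[OF m, of \<i>] S[OF m, of "- \<i>"]
      by (auto simp: abs_le_iff)
    then have S2: "cmod ?S \<le> 2 * (real n * \<delta>)"
      using cmod_le[of ?S] by linarith
    have "(\<Sum>k=1..n. Re ((X k / z) ^ m)) = Re (?S / z ^ m)"
      by (simp add: power_divide sum_divide_distrib)
    also have "\<dots> \<le> cmod (?S / z ^ m)" by (rule complex_Re_le_cmod)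
    also have "\<dots> = cmod ?S / cmod z ^ m" by (simp add: norm_divide norm_power)
    also have "\<dots> \<le> cmod ?S / 1"
      using z0 by (intro divide_left_mono one_le_power) auto
    finally show ?thesis using S2 by simp
  qed
  \<comment> \<open>The directions 1 and -1 put the same bound on a real number and on its negative,
    so that bound is nonnegative.\<close>
  have \<delta>: "0 \<le> real n * \<delta>" if "N \<noteq> 0"
  proof -
    have "1 \<in> {1..N}" using that by auto
    from Sm[OF this] S[OF this, of 1] S[OF this, of "- 1"] show ?thesis by auto
  qed
  have "ln (cmod (root_poly n X z)) = (\<Sum>k=1..n. ln (cmod z) + ln (cmod (1 - X k / z)))"
  proof -
    have "ln (\<Prod>k\<in>{1..n}. cmod z * cmod (1 - X k / z)) = (\<Sum>k=1..n. ln (cmod z * cmod (1 - X k / z)))"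
      using nz z0 by (intro ln_prod) auto
    also have "\<dots> = (\<Sum>k=1..n. ln (cmod z) + ln (cmod (1 - X k / z)))"
    proof (rule sum.cong)
      fix k assume "k \<in> {1..n}"
      with nz z0 show "ln (cmod z * cmod (1 - X k / z)) = ln (cmod z) + ln (cmod (1 - X k / z))"
        by (intro ln_mult_pos) auto
    qed simp
    finally show ?thesis by (simp add: root_poly_def prod_norm[symmetric] factor)
  qed
  also have "\<dots> \<ge> (\<Sum>k=1..n. ln (cmod z) + (- (\<Sum>m=1..N. Re ((X k / z) ^ m) / real m) - T))"
    unfolding T_def using u_le q by (intro sum_mono add_left_mono ln_cmod_one_minus_ge)
  also have "(\<Sum>k=1..n. ln (cmod z) + (- (\<Sum>m=1..N. Re ((X k / z) ^ m) / real m) - T))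
     = real n * (ln (cmod z) - T) - (\<Sum>m=1..N. (\<Sum>k=1..n. Re ((X k / z) ^ m)) / real m)"
    by (simp add: sum.distrib sum_subtractf sum_negf sum_divide_distrib sum.swap[of _ "{1..n}"] algebra_simps)
  finally have ge: "real n * (ln (cmod z) - T) - (\<Sum>m=1..N. (\<Sum>k=1..n. Re ((X k / z) ^ m)) / real m)
     \<le> ln (cmod (root_poly n X z))" .
  have "(\<Sum>m=1..N. (\<Sum>k=1..n. Re ((X k / z) ^ m)) / real m) \<le> (\<Sum>m=1..N. 2 * (real n * \<delta>))"
  proof (rule sum_mono)
    fix m assume m: "m \<in> {1..N}"
    have "(\<Sum>k=1..n. Re ((X k / z) ^ m)) / real m \<le> 2 * (real n * \<delta>) / real m"
      using Sm[OF m] by (intro divide_right_mono) auto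
    also have "\<dots> \<le> 2 * (real n * \<delta>) / 1"
      using m \<delta> by (intro divide_left_mono) auto
    finally show "(\<Sum>k=1..n. Re ((X k / z) ^ m)) / real m \<le> 2 * (real n * \<delta>)" by simp
  qed
  also have "\<dots> = real n * (2 * \<delta> * real N)" by simp
  also have "\<dots> \<le> real n * (ln s - T)"
    using ln_s by (intro mult_left_mono) (auto simp: T_def q_def)
  also have "\<dots> \<le> real n * (ln (cmod z) - T)"
    using z s by (intro mult_left_mono diff_right_mono ln_mono) auto
  finally have "0 \<le> ln (cmod (root_poly n X z))" using ge by linarith
  moreover have "cmod (root_poly n X z) > 0"
    using nz z0 by (auto simp: root_poly_def prod_norm[symmetric] factor intro!: prod_pos)
  ultimately show ?thesis by simp
qed

section \<open>Measurability of conditions quantified over uncountably many points\<close>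

lemma sets_Ball_open_le:
  fixes f :: "'a \<Rightarrow> complex \<Rightarrow> real"
  assumes U: "open U" and cont: "\<And>x. x \<in> space M \<Longrightarrow> continuous_on UNIV (f x)"
    and [measurable]: "\<And>z. (\<lambda>x. f x z) \<in> borel_measurable M"
  shows "{x \<in> space M. \<forall>z\<in>U. f x z \<le> c} \<in> sets M"
proof -
  obtain D :: "complex set" where D: "countable D" "\<And>X. open X \<Longrightarrow> X \<noteq> {} \<Longrightarrow> \<exists>d\<in>D. d \<in> X"
    using countable_dense_exists by metis
  \<comment> \<open>By continuity, violating a non-strict bound is an open condition on
    \<open>z\<close>, so inside the open set \<open>U\<close> it also happens at a point of the
    countable dense set \<open>D\<close>.\<close>
  have "{x \<in> space M. \<forall>z\<in>U. f x z \<le> c} = {x \<in> space M. \<forall>z\<in>U \<inter> D. f x z \<le> c}"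
  proof (intro Collect_cong conj_cong refl iffI ballI)
    fix x z assume x: "x \<in> space M" and le: "\<forall>z\<in>U \<inter> D. f x z \<le> c" and z: "z \<in> U"
    show "f x z \<le> c"
    proof (rule ccontr)
      assume "\<not> f x z \<le> c"
      then have "z \<in> U \<inter> {z. c < f x z}" using z by auto
      moreover have "open (U \<inter> {z. c < f x z})"
        using U cont[OF x] by (intro open_Int open_Collect_less continuous_on_const) auto
      ultimately obtain d where "d \<in> D" "d \<in> U" "c < f x d" using D(2) by fast
      with le show False by force
    qed
  qed auto
  also have "\<dots> \<in> sets M"
    using D(1) by (intro sets.sets_Collect_countable_All') auto
  finally show ?thesis .
qed

text \<open>A strict bound on a dense set need not persist in the limit. On a compact smaller disc
  the supremum is attained, so strictness means a gap \<open>1 / real (Suc k)\<close>, and the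
  condition becomes a countable combination of non-strict ones.\<close>

lemma sets_Ball_ball_less:
  fixes f :: "'a \<Rightarrow> complex \<Rightarrow> real"
  assumes r: "0 < r" and cont: "\<And>x. x \<in> space M \<Longrightarrow> continuous_on UNIV (f x)"
    and meas: "\<And>z. (\<lambda>x. f x z) \<in> borel_measurable M"
  shows "{x \<in> space M. \<forall>z\<in>ball 0 r. f x z < c} \<in> sets M"
proof -
  define \<rho> where "\<rho> m = r - r / real (Suc (Suc m))" for m
  have \<rho>: "\<rho> m < r" for m using r by (simp add: \<rho>_def)
  have "{x \<in> space M. \<forall>z\<in>ball 0 r. f x z < c}
    = {x \<in> space M. \<forall>m. \<exists>k. \<forall>z\<in>ball 0 (\<rho> m). f x z \<le> c - 1 / real (Suc k)}"
  proof (intro Collect_cong conj_cong refl iffI allI ballI)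
    fix x m assume x: "x \<in> space M" and lt: "\<forall>z\<in>ball 0 r. f x z < c"
    have "0 \<le> \<rho> m" using r by (simp add: \<rho>_def field_simps)
    then have "\<exists>z\<in>cball (0::complex) (\<rho> m). \<forall>y\<in>cball (0::complex) (\<rho> m). f x y \<le> f x z"
      using cont[OF x] by (intro continuous_attains_sup) (auto intro: continuous_on_subset)
    then obtain z where z: "z \<in> cball 0 (\<rho> m)" "\<And>y. y \<in> cball 0 (\<rho> m) \<Longrightarrow> f x y \<le> f x z" by auto
    have "f x z < c" using lt z(1) \<rho>[of m] by auto
    then obtain k where k: "1 / real (Suc k) < c - f x z"
      using reals_Archimedean[of "c - f x z"] by (auto simp: inverse_eq_divide)
    show "\<exists>k. \<forall>z\<in>ball 0 (\<rho> m). f x z \<le> c - 1 / real (Suc k)"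
    proof (intro exI[of _ k] ballI)
      fix y :: complex assume "y \<in> ball 0 (\<rho> m)"
      then have "f x y \<le> f x z" by (intro z(2)) auto
      then show "f x y \<le> c - 1 / real (Suc k)" using k by linarith
    qed
  next
    fix x z assume all: "\<forall>m. \<exists>k. \<forall>z\<in>ball 0 (\<rho> m). f x z \<le> c - 1 / real (Suc k)" and z: "z \<in> ball (0::complex) r"
    then have "0 < (r - cmod z) / r" using r by simp
    then obtain m where "inverse (real (Suc m)) < (r - cmod z) / r"
      using reals_Archimedean by blast
    moreover have "inverse (real (Suc (Suc m))) < inverse (real (Suc m))" by simp
    ultimately have "inverse (real (Suc (Suc m))) < (r - cmod z) / r" by linarith
    then have "r / real (Suc (Suc m)) < r - cmod z"
      using r by (simp add: field_simps)
    then have "z \<in> ball 0 (\<rho> m)" by (simp add: \<rho>_def)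
    then obtain k where "f x z \<le> c - 1 / real (Suc k)" using all by blast
    moreover have "1 / real (Suc k) > 0" by simp
    ultimately show "f x z < c" by linarith
  qed
  also have "\<dots> \<in> sets M"
    by (intro sets.sets_Collect_countable_All sets.sets_Collect_countable_Ex sets_Ball_open_le cont meas) auto
  finally show ?thesis .
qed

text \<open>Every point of the circle |z| = s is the limit of the points (1 + 1 / (k + 1)) z
  strictly outside it, so by continuity the open complement of \<open>cball 0 s\<close>
  decides.\<close>

lemma sets_Ball_compl_ball_ge:
  fixes f :: "'a \<Rightarrow> complex \<Rightarrow> real"
  assumes s: "0 < s" and cont: "\<And>x. x \<in> space M \<Longrightarrow> continuous_on UNIV (f x)"
    and meas [measurable]: "\<And>z. (\<lambda>x. f x z) \<in> borel_measurable M"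
  shows "{x \<in> space M. \<forall>z. s \<le> cmod z \<longrightarrow> c \<le> f x z} \<in> sets M"
proof -
  have "{x \<in> space M. \<forall>z. s \<le> cmod z \<longrightarrow> c \<le> f x z} = {x \<in> space M. \<forall>z\<in>- cball 0 s. - f x z \<le> - c}"
  proof (intro Collect_cong conj_cong refl iffI allI ballI impI)
    fix x z assume x: "x \<in> space M" and all: "\<forall>z\<in>- cball 0 s. - f x z \<le> - c" and z: "s \<le> cmod z"
    let ?z = "\<lambda>k. of_real (1 + 1 / real (Suc k)) * z"
    have "(\<lambda>k. 1 / real (Suc k)) \<longlonglongrightarrow> 0"
      using LIMSEQ_inverse_real_of_nat by (simp add: inverse_eq_divide)
    then have "(\<lambda>k. 1 + 1 / real (Suc k)) \<longlonglongrightarrow> 1 + 0"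
      by (rule tendsto_add[OF tendsto_const])
    then have "?z \<longlonglongrightarrow> of_real (1 + 0) * z"
      by (intro tendsto_mult tendsto_of_real tendsto_const)
    then have "(\<lambda>k. f x (?z k)) \<longlonglongrightarrow> f x z"
      using cont[OF x] by (intro continuous_on_tendsto_compose[of UNIV "f x"]) auto
    moreover have "c \<le> f x (?z k)" for k
    proof -
      have "s * 1 < cmod z * (1 + 1 / real (Suc k))"
        using z s by (intro mult_le_less_imp_less) auto
      also have "\<dots> = cmod (?z k)" unfolding norm_mult norm_of_real by (simp add: mult.commute)
      finally have "?z k \<in> - cball 0 s" by simp
      with all show ?thesis by force
    qed
    ultimately show "c \<le> f x z" by (intro LIMSEQ_le_const) auto
  qed auto
  also have "\<dots> \<in> sets M"
    by (intro sets_Ball_open_le open_Compl closed_cball continuous_on_minus cont) measurable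
  finally show ?thesis .
qed

section \<open>A Stirling bound and exponentially small sequences\<close>

lemma fact_le_stirling:
  assumes "n \<ge> 1"
  shows "fact n * exp (real n) \<le> exp 1 * real n * real n ^ n"
  using assms
proof (induction n rule: dec_induct)
  case (step n)
  have n: "real n > 0" using step by auto
  \<comment> \<open>The induction step amounts to e \<le> (1 + 1/n)^(n + 1), the (n + 1)-st power of
    this inequality.\<close>
  have "1 + 1 / real n \<ge> exp (1 / real (Suc n))"
  proof -
    have "1 / (1 + 1 / real n) = 1 + (- 1 / real (Suc n))" using n by (simp add: field_simps)
    also have "\<dots> \<le> exp (- 1 / real (Suc n))" by (rule exp_ge_add_one_self)
    finally have "1 / (1 + 1 / real n) \<le> 1 / exp (1 / real (Suc n))" by (simp add: exp_minus inverse_eq_divide)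
    then show ?thesis using n by (simp add: field_simps)
  qed
  then have "exp (1 / real (Suc n)) ^ Suc n \<le> (1 + 1 / real n) ^ Suc n"
    by (intro power_mono) auto
  then have "exp 1 \<le> (1 + 1 / real n) ^ Suc n"
    by (simp only: exp_of_nat_mult[symmetric]) simp
  also have "1 + 1 / real n = real (Suc n) / real n"
    using n by (simp add: field_simps)
  also have "(real (Suc n) / real n) ^ Suc n = real (Suc n) ^ Suc n / real n ^ Suc n"
    by (rule power_divide)
  finally have e: "exp 1 * real n ^ Suc n \<le> real (Suc n) ^ Suc n"
    using n by (simp add: pos_le_divide_eq del: power_Suc)
  have "fact (Suc n) * exp (real (Suc n)) = real (Suc n) * exp 1 * (fact n * exp (real n))"
    by (simp add: exp_add[symmetric] algebra_simps)
  also have "\<dots> \<le> real (Suc n) * exp 1 * (exp 1 * real n * real n ^ n)"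
    using step.IH by (intro mult_left_mono) auto
  also have "\<dots> = exp 1 * real (Suc n) * (exp 1 * real n ^ Suc n)" by simp
  also have "\<dots> \<le> exp 1 * real (Suc n) * real (Suc n) ^ Suc n"
    using e by (intro mult_left_mono) auto
  finally show ?case .
qed simp

text \<open>Leaving the rate unspecified makes the notion stable under finite sums, so union bounds
  need no bookkeeping of constants.\<close>

definition exp_small :: "(nat \<Rightarrow> real) \<Rightarrow> bool" where
  "exp_small b \<longleftrightarrow> (\<exists>c>0. \<forall>\<^sub>F n in sequentially. b n \<le> exp (- c * real n))"

lemma exp_small_exp: "c > 0 \<Longrightarrow> exp_small (\<lambda>n. exp (- c * real n))"
  unfolding exp_small_def by (intro exI[of _ c]) auto

lemma exp_small_mono:
  assumes "exp_small b" "\<forall>\<^sub>F n in sequentially. a n \<le> b n"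
  shows "exp_small a"
proof -
  obtain c where c: "c > 0" "\<forall>\<^sub>F n in sequentially. b n \<le> exp (- c * real n)"
    using assms(1) unfolding exp_small_def by auto
  have "\<forall>\<^sub>F n in sequentially. a n \<le> exp (- c * real n)"
    using assms(2) c(2) by eventually_elim auto
  with c(1) show ?thesis unfolding exp_small_def by auto
qed

text \<open>Half of the rate is spent on absorbing the polynomial factor.\<close>

lemma exp_small_poly:
  assumes c: "c > 0"
  shows "exp_small (\<lambda>n. C * real n ^ k * exp (- c * real n))"
proof -
  have "((\<lambda>n. C * (real n ^ k / exp (c / 2 * real n))) \<longlonglongrightarrow> C * 0)"
  proof (intro tendsto_mult tendsto_const)
    have "((\<lambda>x. (2 / c) ^ k * ((c / 2 * x) ^ k / exp (c / 2 * x))) \<longlongrightarrow> (2 / c) ^ k * 0) at_top"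
      using c by (intro tendsto_mult tendsto_const filterlim_compose[OF tendsto_power_div_exp_0]
        filterlim_tendsto_pos_mult_at_top[OF tendsto_const _ filterlim_ident]) auto
    then have "((\<lambda>x. x ^ k / exp (c / 2 * x)) \<longlongrightarrow> 0) at_top"
      using c by (simp add: power_mult_distrib power_divide)
    from filterlim_compose[OF this filterlim_real_sequentially]
    show "(\<lambda>n. real n ^ k / exp (c / 2 * real n)) \<longlonglongrightarrow> 0" .
  qed
  then have "\<forall>\<^sub>F n in sequentially. C * (real n ^ k / exp (c / 2 * real n)) < 1"
    by (intro order_tendstoD) auto
  then have "\<forall>\<^sub>F n in sequentially. C * real n ^ k * exp (- c * real n) \<le> exp (- (c / 2) * real n)"
  proof eventually_elim
    case (elim n)
    have "C * real n ^ k * exp (- c * real n)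
        = C * (real n ^ k / exp (c / 2 * real n)) * exp (- (c / 2) * real n)"
      by (simp add: exp_minus field_simps exp_add[symmetric])
    also have "\<dots> \<le> 1 * exp (- (c / 2) * real n)"
      using elim by (intro mult_right_mono) auto
    finally show ?case by simp
  qed
  with c show ?thesis unfolding exp_small_def by (intro exI[of _ "c / 2"]) auto
qed

lemma exp_small_add:
  assumes "exp_small a" "exp_small b"
  shows "exp_small (\<lambda>n. a n + b n)"
proof -
  obtain c1 c2 where c: "c1 > 0" "c2 > 0"
    and a: "\<forall>\<^sub>F n in sequentially. a n \<le> exp (- c1 * real n)"
    and b: "\<forall>\<^sub>F n in sequentially. b n \<le> exp (- c2 * real n)"
    using assms unfolding exp_small_def by auto
  define c where "c = min c1 c2"
  have "\<forall>\<^sub>F n in sequentially. a n + b n \<le> 2 * real n ^ 0 * exp (- c * real n)"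
    using a b
  proof eventually_elim
    case (elim n)
    have "exp (- c1 * real n) \<le> exp (- c * real n)" "exp (- c2 * real n) \<le> exp (- c * real n)"
      by (auto simp: c_def intro!: mult_right_mono)
    then have "a n + b n \<le> 2 * exp (- c * real n)" using elim by linarith
    then show ?case by simp
  qed
  then show ?thesis
    using c by (intro exp_small_mono[OF exp_small_poly[of c 2 0]]) (auto simp: c_def)
qed

lemma exp_small_sum:
  assumes "finite I" "\<And>i. i \<in> I \<Longrightarrow> exp_small (b i)"
  shows "exp_small (\<lambda>n. \<Sum>i\<in>I. b i n)"
  using assms
proof (induction I rule: finite_induct)
  case empty
  then show ?case by (auto simp: exp_small_def intro!: exI[of _ 1])
next
  case (insert i I)
  then have "exp_small (\<lambda>n. b i n + (\<Sum>i\<in>I. b i n))"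
    by (intro exp_small_add) auto
  with insert.hyps show ?case by simp
qed

section \<open>The lemniscate\<close>

lemma exp_small_inner_disc:
  assumes r: "0 \<le> r" "r < 1"
  shows "exp_small (\<lambda>n. real (Suc n) * fact n * exp (real n * r\<^sup>2) / real n ^ n)"
proof (rule exp_small_mono)
  have "r\<^sup>2 < 1" using r by (simp add: power_less_one_iff abs_square_less_1)
  then show "exp_small (\<lambda>n. (2 * exp 1) * real n ^ 2 * exp (- (1 - r\<^sup>2) * real n))"
    by (intro exp_small_poly) auto
  show "\<forall>\<^sub>F n in sequentially. real (Suc n) * fact n * exp (real n * r\<^sup>2) / real n ^ n
      \<le> (2 * exp 1) * real n ^ 2 * exp (- (1 - r\<^sup>2) * real n)"
    using eventually_ge_at_top[of 1]
  proof eventually_elim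
    case (elim n)
    have n: "real n > 0" using elim by simp
    have "fact n \<le> exp 1 * real n * real n ^ n * exp (- real n)"
      using fact_le_stirling[OF elim] by (simp add: exp_minus field_simps)
    then have "real (Suc n) * fact n \<le> (2 * real n) * (exp 1 * real n * real n ^ n * exp (- real n))"
      using elim by (intro mult_mono) auto
    then have "real (Suc n) * fact n * exp (real n * r\<^sup>2) / real n ^ n
      \<le> (2 * real n) * (exp 1 * real n * real n ^ n * exp (- real n)) * exp (real n * r\<^sup>2) / real n ^ n"
      by (intro divide_right_mono mult_right_mono) auto
    also have "\<dots> = (2 * exp 1) * real n ^ 2 * (exp (- real n) * exp (real n * r\<^sup>2))"
      using n by (simp add: power2_eq_square)
    also have "exp (- real n) * exp (real n * r\<^sup>2) = exp (- (1 - r\<^sup>2) * real n)"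
      by (simp add: exp_add[symmetric] algebra_simps)
    finally show ?case .
  qed
qed

lemma exp_small_radius:
  assumes \<rho>: "1 < \<rho>"
  obtains \<tau> where "0 \<le> \<tau>" "\<tau> < 1"
    "exp_small (\<lambda>n. real n * (exp (- \<tau> * (\<rho> * sqrt (real n))\<^sup>2) / (1 - \<tau>) ^ n))"
proof -
  \<comment> \<open>the minimiser of \<open>- \<tau> * \<rho>\<^sup>2 - ln (1 - \<tau>)\<close>, i.e. the optimal Chernoff parameter\<close>
  define \<tau> where "\<tau> = 1 - 1 / \<rho>\<^sup>2"
  \<comment> \<open>Minus the value at that minimiser, hence the decay rate; it is positive because
    ln x < x - 1 for x > 1.\<close>
  define c where "c = \<rho>\<^sup>2 - 1 - ln (\<rho>\<^sup>2)"
  have \<rho>2: "1 < \<rho>\<^sup>2" using \<rho> by (simp add: one_less_power)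
  then have c: "c > 0"
    using ln_le_minus_one[of "\<rho>\<^sup>2"] ln_eq_minus_one[of "\<rho>\<^sup>2"] by (fastforce simp: c_def)
  have \<rho>0: "0 < \<rho>\<^sup>2" using \<rho>2 by linarith
  then have \<tau>: "0 \<le> \<tau>" "\<tau> < 1" using \<rho>2 by (simp_all add: \<tau>_def)
  have "real n * (exp (- \<tau> * (\<rho> * sqrt (real n))\<^sup>2) / (1 - \<tau>) ^ n)
      = 1 * real n ^ 1 * exp (- c * real n)" for n
  proof -
    have "1 / (1 - \<tau>) ^ n = (\<rho>\<^sup>2) ^ n" by (simp add: \<tau>_def power_one_over[symmetric])
    also have "\<dots> = exp (real n * ln (\<rho>\<^sup>2))" using \<rho>0 by (simp only: exp_of_nat_mult exp_ln)
    finally have 1: "1 / (1 - \<tau>) ^ n = exp (real n * ln (\<rho>\<^sup>2))" .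
    have "\<tau> * \<rho>\<^sup>2 = \<rho>\<^sup>2 - 1" using \<rho> by (simp add: \<tau>_def left_diff_distrib)
    then have 2: "\<tau> * (\<rho> * sqrt (real n))\<^sup>2 = (\<rho>\<^sup>2 - 1) * real n"
      by (simp add: power_mult_distrib mult.assoc[symmetric])
    have "exp (- \<tau> * (\<rho> * sqrt (real n))\<^sup>2) / (1 - \<tau>) ^ n
      = exp (- ((\<rho>\<^sup>2 - 1) * real n)) * exp (real n * ln (\<rho>\<^sup>2))"
      unfolding 1[symmetric] 2[symmetric] by simp
    also have "\<dots> = exp (- c * real n)"
      by (simp add: exp_add[symmetric] c_def algebra_simps)
    finally show ?thesis by simp
  qed
  then have "exp_small (\<lambda>n. real n * (exp (- \<tau> * (\<rho> * sqrt (real n))\<^sup>2) / (1 - \<tau>) ^ n))"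
    using exp_small_poly[OF c, of 1 1] by presburger
  with \<tau> show ?thesis by (rule that)
qed

lemma exists_tilt:
  fixes \<rho> \<delta> :: real
  assumes "0 < \<rho>" "0 < \<delta>"
  obtains t c where "0 \<le> t" "t * \<rho> ^ m \<le> 1" "0 < c" "t\<^sup>2 * \<rho> ^ (2 * m) - t * \<delta> = - c"
proof
  define a where "a = \<rho> ^ m"
  have a: "a > 0" using assms by (simp add: a_def)
  \<comment> \<open>The quadratic \<open>t\<^sup>2 * a\<^sup>2 - t * \<delta>\<close> is minimal at
    \<delta> / (2 a^2); capping by 1 / a enforces \<open>t * a \<le> 1\<close> and keeps the value
    negative.\<close>
  define t where "t = min (1 / a) (\<delta> / (2 * a\<^sup>2))"
  have t: "t > 0" using a assms by (simp add: t_def)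
  show "0 \<le> t" using t by simp
  have "t \<le> 1 / a" by (simp add: t_def)
  then show "t * \<rho> ^ m \<le> 1" using a by (simp add: a_def field_simps)
  have "t \<le> \<delta> / (2 * a\<^sup>2)" by (simp add: t_def)
  then have "t * a\<^sup>2 \<le> \<delta> / 2" using a by (simp add: field_simps)
  then have "t * (t * a\<^sup>2) < t * \<delta>" using t assms by (intro mult_strict_left_mono) auto
  moreover have "\<rho> ^ (2 * m) = a\<^sup>2" by (simp add: a_def power_mult[symmetric] mult.commute)
  ultimately show "0 < t * \<delta> - t\<^sup>2 * \<rho> ^ (2 * m)" by (simp add: power2_eq_square mult_ac)
  show "t\<^sup>2 * \<rho> ^ (2 * m) - t * \<delta> = - (t * \<delta> - t\<^sup>2 * \<rho> ^ (2 * m))" by simp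
qed

lemma continuous_on_root_poly: "continuous_on UNIV (\<lambda>z. cmod (root_poly n X z))"
  unfolding root_poly_def by (intro continuous_intros)

lemma measurable_root_poly [measurable]:
  "(\<lambda>x. cmod (root_poly n (\<lambda>k. x k / of_real (sqrt (real n))) z)) \<in> borel_measurable (lborel_on {1..n})"
  unfolding root_poly_def by measurable

lemma sets_inner_event:
  assumes "0 < r"
  shows "{x \<in> space (lborel_on {1..n}).
    ball 0 r \<subseteq> lemniscate n (\<lambda>k. x k / of_real (sqrt (real n)))} \<in> sets (lborel_on {1..n})"
proof -
  have "(ball 0 r \<subseteq> lemniscate n X) = (\<forall>z\<in>ball 0 r. cmod (root_poly n X z) < 1)" for X
    by (auto simp: lemniscate_def)
  then show ?thesis
    using sets_Ball_ball_less[where c = 1 and f = "\<lambda>x z. cmod (root_poly n (\<lambda>k. x k / of_real (sqrt (real n))) z)",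
        OF assms continuous_on_root_poly measurable_root_poly]
    by simp
qed

lemma sets_outer_event:
  assumes "0 < s"
  shows "{x \<in> space (lborel_on {1..n}).
    lemniscate n (\<lambda>k. x k / of_real (sqrt (real n))) \<subseteq> ball 0 s} \<in> sets (lborel_on {1..n})"
proof -
  have "(lemniscate n X \<subseteq> ball 0 s) = (\<forall>z. s \<le> cmod z \<longrightarrow> 1 \<le> cmod (root_poly n X z))" for X
  proof -
    have "(lemniscate n X \<subseteq> ball 0 s) = (\<forall>z. cmod (root_poly n X z) < 1 \<longrightarrow> cmod z < s)"
      by (simp add: lemniscate_def subset_iff)
    also have "\<dots> = (\<forall>z. s \<le> cmod z \<longrightarrow> 1 \<le> cmod (root_poly n X z))"
      by (meson not_le)
    finally show ?thesis .
  qed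
  then show ?thesis
    using sets_Ball_compl_ball_ge[where c = 1 and f = "\<lambda>x z. cmod (root_poly n (\<lambda>k. x k / of_real (sqrt (real n))) z)",
        OF assms continuous_on_root_poly measurable_root_poly]
    by simp
qed

text \<open>The constants are fixed in the order \<rho>, N, \<delta>, all independent of n. The
  exceptional event is then covered by the large-radius event and 4 N power sum events, each
  exponentially small.\<close>

lemma ginibre_outer_disc:
  assumes s: "1 < s"
  shows "exp_small (\<lambda>n. measure (ginibre n) {x \<in> space (lborel_on {1..n}).
      \<not> lemniscate n (\<lambda>k. x k / of_real (sqrt (real n))) \<subseteq> ball 0 s})"
proof -
  define \<rho> where "\<rho> = (1 + s) / 2"
  have \<rho>: "1 < \<rho>" "\<rho> < s" "0 < \<rho>" using s by (auto simp: \<rho>_def)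
  define q where "q = \<rho> / s"
  have q: "0 \<le> q" "q < 1" using \<rho> s by (auto simp: q_def)
  have ln_s: "ln s > 0" using s by simp
  have "(\<lambda>N. q ^ Suc N / (1 - q)) \<longlonglongrightarrow> 0 / (1 - q)"
    using q by (intro tendsto_divide[OF LIMSEQ_Suc[OF LIMSEQ_power_zero] tendsto_const]) auto
  then have "\<forall>\<^sub>F N in sequentially. q ^ Suc N / (1 - q) < ln s / 2"
    using ln_s by (intro order_tendstoD) auto
  then obtain N where N: "q ^ Suc N / (1 - q) < ln s / 2"
    by (auto simp: eventually_sequentially)
  \<comment> \<open>Half of \<open>ln s\<close> is reserved for the tail of the series and half for
    the power sums; \<open>Suc N\<close> instead of \<open>N\<close> covers the case N = 0.\<close>
  define \<delta> where "\<delta> = ln s / (4 * real (Suc N))"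
  have \<delta>: "\<delta> > 0" using ln_s by (simp add: \<delta>_def)
  have "2 * \<delta> * real N \<le> 2 * \<delta> * real (Suc N)" using \<delta> by (intro mult_left_mono) auto
  also have "\<dots> = ln s / 2" by (simp add: \<delta>_def del: of_nat_Suc)
  finally have cond: "2 * \<delta> * real N + q ^ Suc N / (1 - q) \<le> ln s" using N by linarith
  obtain \<tau> where \<tau>: "0 \<le> \<tau>" "\<tau> < 1" and
    small: "exp_small (\<lambda>n. real n * (exp (- \<tau> * (\<rho> * sqrt (real n))\<^sup>2) / (1 - \<tau>) ^ n))"
    using exp_small_radius[OF \<rho>(1)] by blast
  have "\<forall>m. \<exists>t c. 0 \<le> t \<and> t * \<rho> ^ m \<le> 1 \<and> 0 < c \<and> t\<^sup>2 * \<rho> ^ (2 * m) - t * \<delta> = - c"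
    using exists_tilt[OF \<rho>(3) \<delta>] by metis
  then obtain t c where tc: "\<And>m. 0 \<le> t m" "\<And>m. t m * \<rho> ^ m \<le> 1" "\<And>m. 0 < c m"
    "\<And>m. (t m)\<^sup>2 * \<rho> ^ (2 * m) - t m * \<delta> = - c m"
    by metis
  define \<Omega> :: "complex set" where "\<Omega> = {1, - 1, \<i>, - \<i>}"
  define K where "K = {1..N} \<times> \<Omega>"
  have K: "finite K" by (simp add: K_def \<Omega>_def)
  define bound where "bound n = real n * (exp (- \<tau> * (\<rho> * sqrt (real n))\<^sup>2) / (1 - \<tau>) ^ n)
     + (\<Sum>p\<in>K. exp (- c (fst p) * real n))" for n
  have "exp_small (\<lambda>n. \<Sum>p\<in>K. exp (- c (fst p) * real n))"
    using K tc(3) by (intro exp_small_sum exp_small_exp)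
  then have "exp_small bound"
    unfolding bound_def using small by (rule exp_small_add[rotated])
  moreover have "\<forall>\<^sub>F n in sequentially. measure (ginibre n) {x \<in> space (lborel_on {1..n}).
      \<not> lemniscate n (\<lambda>k. x k / of_real (sqrt (real n))) \<subseteq> ball 0 s} \<le> bound n"
    using eventually_ge_at_top[of 1]
  proof eventually_elim
    case (elim n)
    let ?X = "\<lambda>x k. x k / complex_of_real (sqrt (real n))"
    define B where "B = {x \<in> space (lborel_on {1..n}). \<not> (\<forall>k\<in>{1..n}. cmod (x k) \<le> \<rho> * sqrt (real n))}"
    define A where "A p = {x \<in> space (lborel_on {1..n}). (\<forall>k\<in>{1..n}. cmod (x k) \<le> \<rho> * sqrt (real n)) \<and>
      real n * \<delta> \<le> Re (snd p * (\<Sum>k=1..n. (?X x k) ^ fst p))}" for p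
    have AB: "B \<in> sets (ginibre n)" "\<And>p. A p \<in> sets (ginibre n)"
      unfolding A_def B_def sets_ginibre by measurable
    have "{x \<in> space (lborel_on {1..n}). \<not> lemniscate n (?X x) \<subseteq> ball 0 s} \<subseteq> B \<union> (\<Union>p\<in>K. A p)"
    proof (rule subsetI, rule ccontr)
      fix x assume x: "x \<in> {x \<in> space (lborel_on {1..n}). \<not> lemniscate n (?X x) \<subseteq> ball 0 s}"
        and not: "x \<notin> B \<union> (\<Union>p\<in>K. A p)"
      have rad: "\<forall>k\<in>{1..n}. cmod (x k) \<le> \<rho> * sqrt (real n)"
        using x not by (auto simp: B_def)
      have ge: "1 \<le> cmod (root_poly n (?X x) z)" if z: "s \<le> cmod z" for z
      proof (rule root_poly_ge_1[OF _ \<rho>(3,2) s _ cond[unfolded q_def] z])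
        show "cmod (?X x k) \<le> \<rho>" if "k \<in> {1..n}" for k
          using rad that elim by (auto simp: norm_divide divide_simps)
        show "Re (\<omega> * (\<Sum>k=1..n. ?X x k ^ m)) \<le> real n * \<delta>"
          if "m \<in> {1..N}" "\<omega> \<in> {1, - 1, \<i>, - \<i>}" for m \<omega>
        proof -
          have "(m, \<omega>) \<in> K" using that by (simp add: K_def \<Omega>_def)
          then have "x \<notin> A (m, \<omega>)" using not by blast
          then show ?thesis using rad x by (auto simp: A_def)
        qed
      qed
      have "lemniscate n (?X x) \<subseteq> ball 0 s"
      proof
        fix z assume "z \<in> lemniscate n (?X x)"
        then have "\<not> s \<le> cmod z" using ge[of z] by (auto simp: lemniscate_def)
        then show "z \<in> ball 0 s" by simp
      qed
      with x show False by blast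
    qed
    then have "measure (ginibre n) {x \<in> space (lborel_on {1..n}). \<not> lemniscate n (?X x) \<subseteq> ball 0 s}
       \<le> measure (ginibre n) (B \<union> (\<Union>p\<in>K. A p))"
      using K AB by (intro ginibre.finite_measure_mono sets.Un sets.finite_UN) auto
    also have "\<dots> \<le> measure (ginibre n) B + measure (ginibre n) (\<Union>p\<in>K. A p)"
      using K AB by (intro measure_Un_le sets.finite_UN) auto
    also have "\<dots> \<le> measure (ginibre n) B + (\<Sum>p\<in>K. measure (ginibre n) (A p))"
      using K AB by (intro add_left_mono measure_UNION_le) auto
    also have "\<dots> \<le> bound n"
      unfolding bound_def
    proof (intro add_mono sum_mono)
      show "measure (ginibre n) B \<le> real n * (exp (- \<tau> * (\<rho> * sqrt (real n))\<^sup>2) / (1 - \<tau>) ^ n)"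
        unfolding B_def using \<rho> by (intro ginibre_radius \<tau>) auto
      fix p assume p: "p \<in> K"
      have "measure (ginibre n) (A p)
          \<le> exp (real n * ((t (fst p))\<^sup>2 * \<rho> ^ (2 * fst p) - t (fst p) * \<delta>))"
        unfolding A_def using p elim \<rho> tc by (intro ginibre_power_sum) (auto simp: K_def \<Omega>_def)
      then show "measure (ginibre n) (A p) \<le> exp (- c (fst p) * real n)"
        unfolding tc(4) by (simp add: mult.commute)
    qed
    finally show ?case .
  qed
  ultimately show ?thesis by (rule exp_small_mono)
qed

theorem theorem1p6:
  fixes M :: "nat \<Rightarrow> 'a measure"
    and lam :: "nat \<Rightarrow> nat \<Rightarrow> 'a \<Rightarrow> complex"
    and r s :: real
  assumes "\<And>n. n \<ge> 1 \<Longrightarrow> prob_space (M n)"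
    and "\<And>n. n \<ge> 1 \<Longrightarrow> ginibre_vector (M n) n (lam n)"
    and "0 < r" "r < 1" and "1 < s"
  shows "overwhelming_probability M
    (\<lambda>n. {\<omega> \<in> space (M n).
       ball 0 r \<subseteq> lemniscate n (\<lambda>k. lam n k \<omega> / of_real (sqrt (real n))) \<and>
       lemniscate n (\<lambda>k. lam n k \<omega> / of_real (sqrt (real n))) \<subseteq> ball 0 s})"
proof -
  let ?L = "\<lambda>n x. lemniscate n (\<lambda>k. x k / of_real (sqrt (real n)))"
  define Bi where "Bi n = {x \<in> space (lborel_on {1..n}). \<not> ball 0 r \<subseteq> ?L n x}" for n
  define Bo where "Bo n = {x \<in> space (lborel_on {1..n}). \<not> ?L n x \<subseteq> ball 0 s}" for n
  have Bi: "Bi n \<in> sets (lborel_on {1..n})" for n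
    unfolding Bi_def using sets_inner_event[OF assms(3)] by (rule sets.sets_Collect_neg)
  have Bo: "Bo n \<in> sets (lborel_on {1..n})" for n
    unfolding Bo_def using sets_outer_event[of s] assms(5) by (intro sets.sets_Collect_neg) auto
  have "exp_small (\<lambda>n. measure (ginibre n) (Bi n))"
  proof (rule exp_small_mono)
    show "exp_small (\<lambda>n. real (Suc n) * fact n * exp (real n * r\<^sup>2) / real n ^ n)"
      using assms by (intro exp_small_inner_disc) auto
    show "\<forall>\<^sub>F n in sequentially. measure (ginibre n) (Bi n)
        \<le> real (Suc n) * fact n * exp (real n * r\<^sup>2) / real n ^ n"
      using eventually_ge_at_top[of 1]
    proof eventually_elim
      case (elim n)
      show ?case
        unfolding Bi_def using elim assms(3) Bi[unfolded Bi_def] by (intro ginibre_inner_disc) auto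
    qed
  qed
  moreover have "exp_small (\<lambda>n. measure (ginibre n) (Bo n))"
    unfolding Bo_def by (rule ginibre_outer_disc[OF assms(5)])
  ultimately have "exp_small (\<lambda>n. measure (ginibre n) (Bi n) + measure (ginibre n) (Bo n))"
    by (rule exp_small_add)
  then obtain c where c: "c > 0" and
    ev: "\<forall>\<^sub>F n in sequentially. measure (ginibre n) (Bi n) + measure (ginibre n) (Bo n) \<le> exp (- c * real n)"
    unfolding exp_small_def by auto
  show ?thesis
    unfolding overwhelming_probability_def
  proof (intro exI[of _ c] conjI c)
    show "\<forall>\<^sub>F n in sequentially.
       {\<omega> \<in> space (M n). ball 0 r \<subseteq> ?L n (\<lambda>k. lam n k \<omega>) \<and> ?L n (\<lambda>k. lam n k \<omega>) \<subseteq> ball 0 s} \<in> sets (M n) \<and>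
       1 - exp (- c * real n) \<le> measure (M n)
         {\<omega> \<in> space (M n). ball 0 r \<subseteq> ?L n (\<lambda>k. lam n k \<omega>) \<and> ?L n (\<lambda>k. lam n k \<omega>) \<subseteq> ball 0 s}"
      using ev eventually_ge_at_top[of 1]
    proof eventually_elim
      case (elim n)
      interpret Mn: prob_space "M n" using assms(1) elim by auto
      let ?f = "\<lambda>\<omega>. \<lambda>k\<in>{1..n}. lam n k \<omega>"
      have f: "?f \<in> M n \<rightarrow>\<^sub>M lborel_on {1..n}"
        and distr: "distr (M n) (lborel_on {1..n}) ?f = ginibre n"
        using distr_ginibre_vector[OF Mn.prob_space_axioms assms(2)] elim by auto
      let ?E = "{\<omega> \<in> space (M n). ball 0 r \<subseteq> ?L n (\<lambda>k. lam n k \<omega>) \<and> ?L n (\<lambda>k. lam n k \<omega>) \<subseteq> ball 0 s}"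
      define G where "G = space (ginibre n) - (Bi n \<union> Bo n)"
      have G: "G \<in> sets (lborel_on {1..n})"
        using Bi Bo by (auto simp: G_def space_ginibre)
      \<comment> \<open>The polynomial reads only the coordinates in \<open>{1..n}\<close>, so
        passing to the extensional vector changes nothing.\<close>
      have L: "?L n (?f \<omega>) = ?L n (\<lambda>k. lam n k \<omega>)" for \<omega>
      proof -
        have "root_poly n (\<lambda>k. ?f \<omega> k / of_real (sqrt (real n))) z
            = root_poly n (\<lambda>k. lam n k \<omega> / of_real (sqrt (real n))) z" for z
          unfolding root_poly_def by (intro prod.cong) auto
        then show ?thesis unfolding lemniscate_def by presburger
      qed
      \<comment> \<open>As a preimage of an event for \<open>ginibre n\<close>, the event inherits
        both its measurability and its probability.\<close>
      have E: "?E = ?f -` G \<inter> space (M n)"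
      proof -
        have "(?f \<omega> \<in> G) = (ball 0 r \<subseteq> ?L n (\<lambda>k. lam n k \<omega>) \<and> ?L n (\<lambda>k. lam n k \<omega>) \<subseteq> ball 0 s)"
          if "\<omega> \<in> space (M n)" for \<omega>
          using measurable_space[OF f that]
          by (simp only: G_def Bi_def Bo_def space_ginibre L mem_Collect_eq Diff_iff Un_iff) blast
        then show ?thesis by blast
      qed
      have "measure (M n) ?E = measure (ginibre n) G"
        unfolding E distr[symmetric] by (rule measure_distr[OF f G, symmetric])
      also have "\<dots> = 1 - measure (ginibre n) (Bi n \<union> Bo n)"
        unfolding G_def using Bi Bo by (intro ginibre.prob_compl) (auto simp: sets_ginibre)
      also have "\<dots> \<ge> 1 - (measure (ginibre n) (Bi n) + measure (ginibre n) (Bo n))"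
        using Bi Bo by (intro diff_left_mono measure_Un_le) (auto simp: sets_ginibre)
      finally have "1 - exp (- c * real n) \<le> measure (M n) ?E" using elim by linarith
      moreover have "?E \<in> sets (M n)"
        unfolding E by (rule measurable_sets[OF f G])
      ultimately show ?case by blast
    qed
  qed
qed

end
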